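(* When all the node weights are integers, the tree partition problem (defined in the context) can be solved in $O(w_0^2n^2)$ time, where $n$ is the number of nodes.
   Context: Tree partition problem (optimization form): given a tree with nodes $1,\ldots,n$, where node $i$ has a weight $w_i\ge0$ and a parameter $s_i\ge0$, and a threshold $w_0$, partition the node set into connected components such that each component has total weight at most $w_0$, minimizing the sum over components of the largest $s_i$ in the component. *)

theory Defs
  imports Complex_Main "HOL-Library.Disjoint_Sets"
begin

section \<open>Undirected graphs and trees\<close>

text \<open>
  A graph is given by a vertex set and a set of two-element edges. The constant \<open>tree\<close> of
  the AFP entry \<open>Graph_Theory\<close> is not usable here: its cycles are directed, so a symmetric
  digraph with an arc is never a tree, whereas some orientations of undirected cycles are.
\<close>

definition simple_graph :: "'a set \<Rightarrow> 'a set set \<Rightarrow> bool" where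
  "simple_graph V E \<longleftrightarrow> finite V \<and> (\<forall>e\<in>E. e \<subseteq> V \<and> card e = 2)"

definition connected_nodes :: "'a set set \<Rightarrow> 'a set \<Rightarrow> bool" where
  "connected_nodes E C \<longleftrightarrow> C \<noteq> {} \<and>
     (\<forall>u\<in>C. \<forall>v\<in>C. (u, v) \<in> {(x, y). x \<in> C \<and> y \<in> C \<and> {x, y} \<in> E}\<^sup>*)"

definition is_cycle :: "'a set set \<Rightarrow> 'a list \<Rightarrow> bool" where
  "is_cycle E xs \<longleftrightarrow> 3 \<le> length xs \<and> distinct xs \<and>
     successively (\<lambda>x y. {x, y} \<in> E) xs \<and> {last xs, hd xs} \<in> E"

definition is_tree :: "'a set \<Rightarrow> 'a set set \<Rightarrow> bool" where
  "is_tree V E \<longleftrightarrow> simple_graph V E \<and> connected_nodes E V \<and> (\<nexists>xs. is_cycle E xs)"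


section \<open>The tree partition problem\<close>

record tree_partition =
  num_nodes :: nat
  edge_list :: "(nat \<times> nat) list"
  weight :: "nat \<Rightarrow> real"
  param :: "nat \<Rightarrow> real"
  threshold :: real

definition nodes :: "tree_partition \<Rightarrow> nat set" where
  "nodes I = {1..num_nodes I}"

definition edges :: "tree_partition \<Rightarrow> nat set set" where
  "edges I = (\<lambda>(u, v). {u, v}) ` set (edge_list I)"

text \<open>The edge list mentions every edge once, in arbitrary order and orientation.\<close>

definition valid_instance :: "tree_partition \<Rightarrow> bool" where
  "valid_instance I \<longleftrightarrow>
     is_tree (nodes I) (edges I) \<and>
     distinct (map (\<lambda>(u, v). {u, v}) (edge_list I)) \<and>
     (\<forall>i\<in>nodes I. 0 \<le> weight I i \<and> 0 \<le> param I i) \<and>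
     0 \<le> threshold I"

definition feasible :: "tree_partition \<Rightarrow> nat set set \<Rightarrow> bool" where
  "feasible I P \<longleftrightarrow> partition_on (nodes I) P \<and>
     (\<forall>C\<in>P. connected_nodes (edges I) C \<and> (\<Sum>i\<in>C. weight I i) \<le> threshold I)"

definition cost :: "tree_partition \<Rightarrow> nat set set \<Rightarrow> real" where
  "cost I P = (\<Sum>C\<in>P. Max (param I ` C))"

definition optimal :: "tree_partition \<Rightarrow> nat set set \<Rightarrow> bool" where
  "optimal I P \<longleftrightarrow> feasible I P \<and> (\<forall>Q. feasible I Q \<longrightarrow> cost I P \<le> cost I Q)"


section \<open>A random access machine over integers and reals\<close>

text \<open>
  Programs are structured programs over finitely many named arrays of integers and of reals,
  both indexed by integers; a scalar is cell 0 of an array. Every executed operation has unit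
  cost. To keep the unit cost measure reasonable, arithmetic consists of addition and
  subtraction only, constants are integers, and there is no conversion (in particular no
  rounding) from reals to integers; reals influence integers only through comparisons.
\<close>

type_synonym vname = string

record memory =
  ints :: "vname \<Rightarrow> int \<Rightarrow> int"
  reals :: "vname \<Rightarrow> int \<Rightarrow> real"

datatype iexp =
    IConst int
  | IRead vname iexp
  | IAdd iexp iexp
  | ISub iexp iexp

datatype rexp =
    RConst int
  | RRead vname iexp
  | RAdd rexp rexp
  | RSub rexp rexp

datatype bexp =
    ILess iexp iexp
  | IEq iexp iexp
  | RLess rexp rexp
  | REq rexp rexp
  | BNot bexp
  | BAnd bexp bexp

datatype com =
    Skip
  | IWrite vname iexp iexp
  | RWrite vname iexp rexp
  | Seq com com
  | Cond bexp com com
  | Loop bexp com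

primrec ival :: "iexp \<Rightarrow> memory \<Rightarrow> int" where
  "ival (IConst k) m = k"
| "ival (IRead x e) m = ints m x (ival e m)"
| "ival (IAdd e1 e2) m = ival e1 m + ival e2 m"
| "ival (ISub e1 e2) m = ival e1 m - ival e2 m"

primrec rval :: "rexp \<Rightarrow> memory \<Rightarrow> real" where
  "rval (RConst k) m = of_int k"
| "rval (RRead x e) m = reals m x (ival e m)"
| "rval (RAdd e1 e2) m = rval e1 m + rval e2 m"
| "rval (RSub e1 e2) m = rval e1 m - rval e2 m"

primrec bval :: "bexp \<Rightarrow> memory \<Rightarrow> bool" where
  "bval (ILess e1 e2) m \<longleftrightarrow> ival e1 m < ival e2 m"
| "bval (IEq e1 e2) m \<longleftrightarrow> ival e1 m = ival e2 m"
| "bval (RLess e1 e2) m \<longleftrightarrow> rval e1 m < rval e2 m"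
| "bval (REq e1 e2) m \<longleftrightarrow> rval e1 m = rval e2 m"
| "bval (BNot b) m \<longleftrightarrow> \<not> bval b m"
| "bval (BAnd b1 b2) m \<longleftrightarrow> bval b1 m \<and> bval b2 m"

primrec itime :: "iexp \<Rightarrow> nat" where
  "itime (IConst k) = 1"
| "itime (IRead x e) = itime e + 1"
| "itime (IAdd e1 e2) = itime e1 + itime e2 + 1"
| "itime (ISub e1 e2) = itime e1 + itime e2 + 1"

primrec rtime :: "rexp \<Rightarrow> nat" where
  "rtime (RConst k) = 1"
| "rtime (RRead x e) = itime e + 1"
| "rtime (RAdd e1 e2) = rtime e1 + rtime e2 + 1"
| "rtime (RSub e1 e2) = rtime e1 + rtime e2 + 1"

primrec btime :: "bexp \<Rightarrow> nat" where
  "btime (ILess e1 e2) = itime e1 + itime e2 + 1"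
| "btime (IEq e1 e2) = itime e1 + itime e2 + 1"
| "btime (RLess e1 e2) = rtime e1 + rtime e2 + 1"
| "btime (REq e1 e2) = rtime e1 + rtime e2 + 1"
| "btime (BNot b) = btime b + 1"
| "btime (BAnd b1 b2) = btime b1 + btime b2 + 1"

definition write_int :: "vname \<Rightarrow> int \<Rightarrow> int \<Rightarrow> memory \<Rightarrow> memory" where
  "write_int x k a m = m\<lparr>ints := (ints m)(x := (ints m x)(k := a))\<rparr>"

definition write_real :: "vname \<Rightarrow> int \<Rightarrow> real \<Rightarrow> memory \<Rightarrow> memory" where
  "write_real x k a m = m\<lparr>reals := (reals m)(x := (reals m x)(k := a))\<rparr>"

text \<open>\<open>exec p m t m'\<close>: started in \<open>m\<close>, program \<open>p\<close> halts in \<open>m'\<close> after exactly \<open>t\<close> steps.\<close>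

inductive exec :: "com \<Rightarrow> memory \<Rightarrow> nat \<Rightarrow> memory \<Rightarrow> bool" where
  Skip: "exec Skip m 1 m"
| IWrite: "exec (IWrite x e1 e2) m (itime e1 + itime e2 + 1)
             (write_int x (ival e1 m) (ival e2 m) m)"
| RWrite: "exec (RWrite x e1 e2) m (itime e1 + rtime e2 + 1)
             (write_real x (ival e1 m) (rval e2 m) m)"
| Seq: "exec p m t m' \<Longrightarrow> exec q m' t' m'' \<Longrightarrow> exec (Seq p q) m (t + t') m''"
| CondTrue: "bval b m \<Longrightarrow> exec p m t m' \<Longrightarrow> exec (Cond b p q) m (btime b + t + 1) m'"
| CondFalse: "\<not> bval b m \<Longrightarrow> exec q m t m' \<Longrightarrow> exec (Cond b p q) m (btime b + t + 1) m'"
| LoopTrue: "bval b m \<Longrightarrow> exec p m t m' \<Longrightarrow> exec (Loop b p) m' t' m'' \<Longrightarrow>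
             exec (Loop b p) m (btime b + t + t' + 1) m''"
| LoopFalse: "\<not> bval b m \<Longrightarrow> exec (Loop b p) m (btime b + 1) m"

inductive_cases exec_SkipE: "exec Skip m t m'"
inductive_cases exec_IWriteE: "exec (IWrite x e1 e2) m t m'"
inductive_cases exec_RWriteE: "exec (RWrite x e1 e2) m t m'"
inductive_cases exec_SeqE: "exec (Seq p q) m t m'"
inductive_cases exec_CondE: "exec (Cond b p q) m t m'"
inductive_cases exec_LoopE: "exec (Loop b p) m t m'"

lemma exec_deterministic:
  "exec p m t m' \<Longrightarrow> exec p m u m'' \<Longrightarrow> t = u \<and> m' = m''"
proof (induction arbitrary: u m'' rule: exec.induct)
  case Skip
  then show ?case by (auto elim: exec_SkipE)
next
  case IWrite
  then show ?case by (auto elim: exec_IWriteE)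
next
  case RWrite
  then show ?case by (auto elim: exec_RWriteE)
next
  case (Seq p m t m1 q t1 m2)
  from Seq.prems obtain a b n where "u = a + b" "exec p m a n" "exec q n b m''"
    by (auto elim: exec_SeqE)
  with Seq.IH show ?case by metis
next
  case (CondTrue b m p t m1 q)
  from CondTrue.prems CondTrue.hyps obtain a where "u = btime b + a + 1" "exec p m a m''"
    by (auto elim: exec_CondE)
  with CondTrue.IH show ?case by metis
next
  case (CondFalse b m q t m1 p)
  from CondFalse.prems CondFalse.hyps obtain a where "u = btime b + a + 1" "exec q m a m''"
    by (auto elim: exec_CondE)
  with CondFalse.IH show ?case by metis
next
  case (LoopTrue b m p t m1 t1 m2)
  from LoopTrue.prems LoopTrue.hyps obtain a c n
    where "u = btime b + a + c + 1" "exec p m a n" "exec (Loop b p) n c m''"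
    by (auto elim: exec_LoopE)
  with LoopTrue.IH show ?case by metis
next
  case LoopFalse
  then show ?case by (auto elim: exec_LoopE)
qed


section \<open>Input and output\<close>

text \<open>
  Node weights are put into integer cells, which loses nothing if they are integers; the
  parameters and the threshold are real cells. All cells not used by the input are 0.
\<close>

definition input_ints :: "tree_partition \<Rightarrow> vname \<Rightarrow> int \<Rightarrow> int" where
  "input_ints I x k =
     (if x = ''n'' \<and> k = 0 then int (num_nodes I)
      else if x = ''m'' \<and> k = 0 then int (length (edge_list I))
      else if x = ''fst'' \<and> 0 \<le> k \<and> k < int (length (edge_list I))
        then int (fst (edge_list I ! nat k))
      else if x = ''snd'' \<and> 0 \<le> k \<and> k < int (length (edge_list I))
        then int (snd (edge_list I ! nat k))
      else if x = ''w'' \<and> 1 \<le> k \<and> k \<le> int (num_nodes I) then \<lfloor>weight I (nat k)\<rfloor>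
      else 0)"

definition input_reals :: "tree_partition \<Rightarrow> vname \<Rightarrow> int \<Rightarrow> real" where
  "input_reals I x k =
     (if x = ''s'' \<and> 1 \<le> k \<and> k \<le> int (num_nodes I) then param I (nat k)
      else if x = ''w0'' \<and> k = 0 then threshold I
      else 0)"

definition input_memory :: "tree_partition \<Rightarrow> memory" where
  "input_memory I = \<lparr>ints = input_ints I, reals = input_reals I\<rparr>"

text \<open>The output partition is given by labels: two nodes share a block iff their labels agree.\<close>

definition output_partition :: "tree_partition \<Rightarrow> memory \<Rightarrow> nat set set" where
  "output_partition I m =
     (\<lambda>i. {j \<in> nodes I. ints m ''label'' (int j) = ints m ''label'' (int i)}) ` nodes I"

definition correct_output :: "tree_partition \<Rightarrow> memory \<Rightarrow> bool" where
  "correct_output I m \<longleftrightarrow>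
     (if \<exists>P. feasible I P
      then ints m ''feasible'' 0 = 1 \<and> optimal I (output_partition I m) \<and>
           reals m ''cost'' 0 = cost I (output_partition I m)
      else ints m ''feasible'' 0 = 0)"

end

theory Submission
  imports Defs
begin

text \<open>
  Order the nodes so that every parent precedes its children. For a node \<open>x\<close>, a node \<open>j\<close> and a
  budget \<open>w\<close>, let \<open>f x j w\<close> be the least cost of the finished components below \<open>x\<close> if the
  component of \<open>x\<close> has weight at most \<open>w\<close> and parameters at most \<open>s\<^sub>j\<close> so far. Merging the last
  unmerged node \<open>c\<close> into its parent either cuts the edge, at the price of the minimum over \<open>j\<close> of
  \<open>s\<^sub>j + f c j w\<^sub>0\<close>, or splits the budget; this takes \<open>O(w\<^sub>0\<^sup>2)\<close> steps for each \<open>j\<close>.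
  Infinity is replaced by \<open>big = 1 + \<Sum>s\<close>, which exceeds the cost of every feasible partition.

  Both halves of the correctness proof follow the sum, over the nodes not merged yet, of their \<open>f\<close>
  at the current budgets, plus the parameters of the components already opened. This sum is
  constant along the partition read off from the tables, and for an arbitrary feasible partition
  it does not increase as merging proceeds, so no optimal substructure has to be glued together.
\<close>

section \<open>Timed execution of programs\<close>

text \<open>The index \<open>j\<close> guesses a node where the component attains its maximum. Once
  that parameter is fixed as an upper bound and paid when the component is opened, merging only has
  to check the bound node by node and to split the budget. An overestimate merely raises the price,
  so minimizing over \<open>j\<close> is exact; as \<open>j\<close> ranges over all nodes it
  contributes the second factor \<open>n\<close>, next to the \<open>n\<close> merges. Since the
  weights are integers, a component respects the threshold iff it respects \<open>W\<close>, the
  floor of the threshold, and budgets are indexed by 0 to \<open>W\<close>. The machine shapes the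
  rest. It cannot multiply, so the offsets of the tables are built by repeated addition; it cannot
  round, so \<open>W\<close> is found by counting. Every merge writes its table into a fresh region:
  all tables survive, the recurrences become statements about one final memory, and the traceback
  can read them there. The edges come in arbitrary order, but \<open>n\<close> scans of the list
  produce the required order of the nodes within O(n^2) steps.\<close>

definition runs :: "com \<Rightarrow> memory \<Rightarrow> nat \<Rightarrow> (memory \<Rightarrow> bool) \<Rightarrow> bool" where
  "runs c m T Q \<longleftrightarrow> (\<exists>t m'. exec c m t m' \<and> t \<le> T \<and> Q m')"

lemma runs_mono:
  assumes "runs c m T P" "T \<le> U" "\<And>m'. P m' \<Longrightarrow> Q m'"
  shows "runs c m U Q"
  using assms unfolding runs_def by (meson order_trans)

lemma runs_Seq:
  assumes "runs c m T P" "\<And>m'. P m' \<Longrightarrow> runs d m' U Q"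
  shows "runs (Seq c d) m (T + U) Q"
proof -
  obtain t m' where 1: "exec c m t m'" "t \<le> T" "P m'"
    using assms(1) unfolding runs_def by blast
  obtain u m'' where "exec d m' u m''" "u \<le> U" "Q m''"
    using assms(2)[OF 1(3)] unfolding runs_def by blast
  with 1 show ?thesis
    unfolding runs_def by (meson exec.Seq add_mono)
qed

section \<open>Frame conditions from syntactic sets of modified arrays\<close>

primrec imods :: "com \<Rightarrow> vname set" where
  "imods Skip = {}"
| "imods (IWrite x a b) = {x}"
| "imods (RWrite x a b) = {}"
| "imods (Seq c d) = imods c \<union> imods d"
| "imods (Cond b c d) = imods c \<union> imods d"
| "imods (Loop b c) = imods c"

primrec rmods :: "com \<Rightarrow> vname set" where
  "rmods Skip = {}"
| "rmods (IWrite x a b) = {}"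
| "rmods (RWrite x a b) = {x}"
| "rmods (Seq c d) = rmods c \<union> rmods d"
| "rmods (Cond b c d) = rmods c \<union> rmods d"
| "rmods (Loop b c) = rmods c"

lemma ints_write_int [simp]: "ints (write_int x k a m) = (ints m)(x := (ints m x)(k := a))"
  and reals_write_int [simp]: "reals (write_int x k a m) = reals m"
  and ints_write_real [simp]: "ints (write_real x k r m) = ints m"
  and reals_write_real [simp]: "reals (write_real x k r m) = (reals m)(x := (reals m x)(k := r))"
  by (simp_all add: write_int_def write_real_def)

text \<open>Unmodified arrays agree as whole functions, so one frame fact rewrites every later read,
  whatever its index.\<close>

definition same :: "com \<Rightarrow> memory \<Rightarrow> memory \<Rightarrow> bool" where
  "same c m m' \<longleftrightarrow> (\<forall>x. x \<notin> imods c \<longrightarrow> ints m' x = ints m x) \<and>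
     (\<forall>x. x \<notin> rmods c \<longrightarrow> reals m' x = reals m x)"

lemma same_trans: "same c m m' \<Longrightarrow> same c m' m'' \<Longrightarrow> same c m m''"
  by (simp add: same_def)

lemma exec_same: "exec c m t m' \<Longrightarrow> same c m m'"
  by (induction rule: exec.induct) (auto simp: same_def)

lemma runs_same:
  assumes "runs c m T Q"
  shows "runs c m T (\<lambda>m'. Q m' \<and> same c m m')"
  using assms exec_same unfolding runs_def by blast

section \<open>Loop-free programs, evaluated by a function\<close>

primrec flat :: "com \<Rightarrow> bool" where
  "flat Skip = True"
| "flat (IWrite x a b) = True"
| "flat (RWrite x a b) = True"
| "flat (Seq c d) = (flat c \<and> flat d)"
| "flat (Cond b c d) = (flat c \<and> flat d)"
| "flat (Loop b c) = False"

text \<open>For loop-free programs the final memory becomes a term that simplification computes. The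
  value on \<open>Loop\<close> is a dummy: \<open>run\<close> is related to \<open>exec\<close> only
  under \<open>flat\<close>.\<close>

primrec run :: "com \<Rightarrow> memory \<Rightarrow> memory" where
  "run Skip m = m"
| "run (IWrite x a b) m = write_int x (ival a m) (ival b m) m"
| "run (RWrite x a b) m = write_real x (ival a m) (rval b m) m"
| "run (Seq c d) m = run d (run c m)"
| "run (Cond b c d) m = (if bval b m then run c m else run d m)"
| "run (Loop b c) m = m"

text \<open>Charging both branches of a conditional keeps the bound independent of the
  memory.\<close>

primrec flat_time :: "com \<Rightarrow> nat" where
  "flat_time Skip = 1"
| "flat_time (IWrite x a b) = itime a + itime b + 1"
| "flat_time (RWrite x a b) = itime a + rtime b + 1"
| "flat_time (Seq c d) = flat_time c + flat_time d"
| "flat_time (Cond b c d) = btime b + flat_time c + flat_time d + 1"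
| "flat_time (Loop b c) = 0"

lemma exec_flat:
  "flat c \<Longrightarrow> \<exists>t \<le> flat_time c. exec c m t (run c m)"
proof (induction c arbitrary: m)
  case (Seq c d)
  then obtain t u where "t \<le> flat_time c" "exec c m t (run c m)"
    "u \<le> flat_time d" "exec d (run c m) u (run d (run c m))"
    by (metis flat.simps(4))
  then show ?case
    by (auto intro!: exI[of _ "t + u"] exec.Seq)
next
  case (Cond b c d)
  then obtain t u where "t \<le> flat_time c" "exec c m t (run c m)"
    "u \<le> flat_time d" "exec d m u (run d m)"
    by (metis flat.simps(5))
  then have "bval b m \<Longrightarrow> exec (Cond b c d) m (btime b + t + 1) (run c m)"
    "\<not> bval b m \<Longrightarrow> exec (Cond b c d) m (btime b + u + 1) (run d m)"
    "btime b + t + 1 \<le> flat_time (Cond b c d)" "btime b + u + 1 \<le> flat_time (Cond b c d)"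
    by (auto intro: exec.CondTrue[simplified] exec.CondFalse[simplified])
  then show ?case
    by (cases "bval b m") fastforce+
qed (auto intro: exec.intros[simplified])

lemma runs_flat:
  assumes "flat c" "Q (run c m)" "flat_time c \<le> T"
  shows "runs c m T Q"
  using exec_flat[OF assms(1), of m] assms(2,3) unfolding runs_def by (meson order_trans)

section \<open>Loops with a known number of rounds\<close>

lemma runs_Loop:
  assumes start: "Inv 0 m"
    and body: "\<And>k m'. k < N \<Longrightarrow> Inv k m' \<Longrightarrow> same c m m' \<Longrightarrow>
      bval b m' \<and> runs c m' T (Inv (Suc k))"
    and stop: "\<And>m'. Inv N m' \<Longrightarrow> same c m m' \<Longrightarrow> \<not> bval b m'"
  shows "runs (Loop b c) m (N * (T + btime b + 1) + btime b + 1) (Inv N)"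
proof -
  have "runs (Loop b c) m' (d * (T + btime b + 1) + btime b + 1) (Inv N)"
    if "Inv k m'" "same c m m'" "k + d = N" for k d m'
    using that
  proof (induction d arbitrary: k m')
    case 0
    then show ?case
      using stop[of m'] exec.LoopFalse[of b m' c] unfolding runs_def by fastforce
  next
    case (Suc d)
    have b: "bval b m'" and "runs c m' T (Inv (Suc k))"
      using body[of k m'] Suc.prems by auto
    then obtain t m1 where 1: "exec c m' t m1" "t \<le> T" "Inv (Suc k) m1" "same c m' m1"
      using exec_same unfolding runs_def by blast
    have "runs (Loop b c) m1 (d * (T + btime b + 1) + btime b + 1) (Inv N)"
      using Suc.IH[of "Suc k" m1] 1 Suc.prems same_trans by simp
    then obtain u m2 where 2: "exec (Loop b c) m1 u m2"
      "u \<le> d * (T + btime b + 1) + btime b + 1" "Inv N m2"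
      unfolding runs_def by blast
    have "exec (Loop b c) m' (btime b + t + u + 1) m2"
      by (rule exec.LoopTrue[OF b 1(1) 2(1)])
    moreover have "btime b + t + u + 1 \<le> Suc d * (T + btime b + 1) + btime b + 1"
      using 1(2) 2(2) by simp
    ultimately show ?case
      using 2(3) unfolding runs_def by blast
  qed
  from this[of 0 m N] start show ?thesis
    by (simp add: same_def)
qed

abbreviation IVar :: "vname \<Rightarrow> iexp" where
  "IVar x \<equiv> IRead x (IConst 0)"

abbreviation RVar :: "vname \<Rightarrow> rexp" where
  "RVar x \<equiv> RRead x (IConst 0)"

abbreviation ISet :: "vname \<Rightarrow> iexp \<Rightarrow> com" where
  "ISet x e \<equiv> IWrite x (IConst 0) e"

abbreviation RSet :: "vname \<Rightarrow> rexp \<Rightarrow> com" where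
  "RSet x e \<equiv> RWrite x (IConst 0) e"

definition For :: "vname \<Rightarrow> iexp \<Rightarrow> com \<Rightarrow> com" where
  "For x e c = Seq (ISet x (IConst 0))
     (Loop (ILess (IVar x) e) (Seq c (ISet x (IAdd (IVar x) (IConst 1)))))"

lemma imods_For [simp]: "imods (For x e c) = insert x (imods c)"
  and rmods_For [simp]: "rmods (For x e c) = rmods c"
  by (auto simp: For_def)

text \<open>By \<open>indep\<close> the invariant tolerates any value of the counter, so
  initialization and increment preserve it. Besides its body, a round costs
  \<open>itime e + 3\<close> for the test, 1 for the loop and 6 for the increment. If the bound
  \<open>e\<close> is a variable, this yields \<open>T + 12\<close> per round and 9 once, the source
  of these constants in the later time bounds.\<close>

lemma runs_For:
  assumes start: "Inv 0 m"
    and counter: "x \<notin> imods c"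
    and bound: "\<And>k m'. ints m' x 0 = int k \<Longrightarrow> same (For x e c) m m' \<Longrightarrow> ival e m' = int N"
    and indep: "\<And>k m' a. Inv k m' \<Longrightarrow> Inv k (write_int x 0 a m')"
    and body: "\<And>k m'. k < N \<Longrightarrow> ints m' x 0 = int k \<Longrightarrow> Inv k m' \<Longrightarrow>
      same (For x e c) m m' \<Longrightarrow> runs c m' T (Inv (Suc k))"
    and time: "N * (T + itime e + 10) + itime e + 7 \<le> U"
  shows "runs (For x e c) m U (\<lambda>m'. Inv N m' \<and> same (For x e c) m m')"
proof (rule runs_same, rule runs_mono)
  let ?b = "ILess (IVar x) e" and ?c = "Seq c (ISet x (IAdd (IVar x) (IConst 1)))"
  let ?m = "write_int x 0 0 m"
  let ?I = "\<lambda>k m'. ints m' x 0 = int k \<and> Inv k m'"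
  have same: "same (For x e c) m m'" if "same ?c ?m m'" for m'
    using that by (auto simp: same_def)
  have "runs (Loop ?b ?c) ?m (N * ((T + 6) + btime ?b + 1) + btime ?b + 1) (?I N)"
  proof (rule runs_Loop)
    show "?I 0 ?m"
      using start indep by simp
  next
    fix k m' assume k: "k < N" and I: "?I k m'" and s: "same ?c ?m m'"
    have "runs ?c m' (T + 6) (?I (Suc k))"
    proof (rule runs_Seq)
      show "runs c m' T (\<lambda>m''. Inv (Suc k) m'' \<and> same c m' m'')"
        using body[OF k _ _ same[OF s]] I by (intro runs_same) auto
    next
      fix m'' assume *: "Inv (Suc k) m'' \<and> same c m' m''"
      then have "ints m'' x 0 = int k"
        using I counter by (simp add: same_def)
      then show "runs (ISet x (IAdd (IVar x) (IConst 1))) m'' 6 (?I (Suc k))"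
        using * by (intro runs_flat) (auto intro: indep)
    qed
    moreover have "bval ?b m'"
      using bound[OF _ same[OF s]] I k by auto
    ultimately show "bval ?b m' \<and> runs ?c m' (T + 6) (?I (Suc k))"
      by blast
  next
    fix m' assume I: "?I N m'" and s: "same ?c ?m m'"
    then show "\<not> bval ?b m'"
      using bound[OF _ same[OF s]] by auto
  qed
  moreover have "runs (ISet x (IConst 0)) m 3 (\<lambda>m'. m' = ?m)"
    by (rule runs_flat) auto
  ultimately show "runs (For x e c) m
      (3 + (N * ((T + 6) + btime ?b + 1) + btime ?b + 1)) (?I N)"
    unfolding For_def by (blast intro: runs_Seq)
qed (use time in \<open>auto simp: algebra_simps\<close>)

section \<open>The dynamic program\<close>

text \<open>\<open>f c x\<close> is the table of \<open>x < c\<close> once the nodes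
  \<open>c\<close> to \<open>n - 1\<close> have been merged into their parents. So
  \<open>f (Suc c) c\<close> is the complete table of \<open>c\<close>, and passing from
  \<open>Suc c\<close> to \<open>c\<close> changes only the table of \<open>par c\<close>.
  \<open>g c\<close> is the price of closing the component topped by \<open>c\<close>, with
  minimizing index \<open>bj c\<close>; \<open>ch\<close> records the winning option, -1 for a cut.
  The minimum is given in two halves: the inequalities \<open>f_cut\<close> and
  \<open>f_keep\<close> serve the lower bound, the attained option \<open>f_choice\<close> serves
  the traceback.\<close>

locale partition_dp =
  fixes n W :: nat and par wt :: "nat \<Rightarrow> nat" and sv :: "nat \<Rightarrow> real" and big :: real
    and f :: "nat \<Rightarrow> nat \<Rightarrow> nat \<Rightarrow> nat \<Rightarrow> real" and g :: "nat \<Rightarrow> real"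
    and bj :: "nat \<Rightarrow> nat" and ch :: "nat \<Rightarrow> nat \<Rightarrow> nat \<Rightarrow> int"
  assumes n_pos: "0 < n"
    and par_less: "\<And>c. 0 < c \<Longrightarrow> c < n \<Longrightarrow> par c < c"
    and sv_nonneg: "\<And>x. x < n \<Longrightarrow> 0 \<le> sv x"
    and big_nonneg: "0 \<le> big"
    and f_init: "\<And>x j w. x < n \<Longrightarrow> j < n \<Longrightarrow> w \<le> W \<Longrightarrow>
      f n x j w = (if wt x \<le> w \<and> sv x \<le> sv j then 0 else big)"
    and bj_less: "\<And>c. c < n \<Longrightarrow> bj c < n"
    and g_eq: "\<And>c. c < n \<Longrightarrow> g c = sv (bj c) + f (Suc c) c (bj c) W"
    and g_le: "\<And>c j. c < n \<Longrightarrow> j < n \<Longrightarrow> g c \<le> sv j + f (Suc c) c j W"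
    and f_other: "\<And>c x. 0 < c \<Longrightarrow> c < n \<Longrightarrow> x < c \<Longrightarrow> x \<noteq> par c \<Longrightarrow> f c x = f (Suc c) x"
    and f_cut: "\<And>c j w. 0 < c \<Longrightarrow> c < n \<Longrightarrow> j < n \<Longrightarrow> w \<le> W \<Longrightarrow>
      f c (par c) j w \<le> f (Suc c) (par c) j w + g c"
    and f_keep: "\<And>c j w u. 0 < c \<Longrightarrow> c < n \<Longrightarrow> j < n \<Longrightarrow> w \<le> W \<Longrightarrow> u \<le> w \<Longrightarrow>
      f c (par c) j w \<le> f (Suc c) (par c) j (w - u) + f (Suc c) c j u"
    and f_choice: "\<And>c j w. 0 < c \<Longrightarrow> c < n \<Longrightarrow> j < n \<Longrightarrow> w \<le> W \<Longrightarrow>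
      ch c j w = - 1 \<and> f c (par c) j w = f (Suc c) (par c) j w + g c \<or>
      (\<exists>u\<le>w. ch c j w = int u \<and>
         f c (par c) j w = f (Suc c) (par c) j (w - u) + f (Suc c) c j u)"
begin

lemma f_nonneg:
  assumes "c \<le> n" "0 < c" "x < c" "j < n" "w \<le> W"
  shows "0 \<le> f c x j w"
  using assms
proof (induction c arbitrary: x j w rule: inc_induct)
  case base
  then show ?case using f_init big_nonneg by auto
next
  case (step c)
  have g: "0 \<le> g c"
    using step g_eq sv_nonneg bj_less by (simp add: step.IH)
  have p: "par c < c" using par_less step by simp
  show ?case
  proof (cases "x = par c")
    case True
    show ?thesis
      using f_choice[of c j w] step p g unfolding True
      by (auto simp: step.IH intro!: add_nonneg_nonneg)
  next
    case False
    then show ?thesis using step f_other by simp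
  qed
qed

text \<open>The option taken at \<open>w\<close> is still available at \<open>w'\<close>, with the
  surplus left to the parent. This lets a cut component that occupies only \<open>B c\<close> be
  charged at the full budget \<open>W\<close> that appears in \<open>g\<close>.\<close>

lemma f_mono:
  assumes "c \<le> n" "0 < c" "x < c" "j < n" "w \<le> w'" "w' \<le> W"
  shows "f c x j w' \<le> f c x j w"
  using assms
proof (induction c arbitrary: x j w w' rule: inc_induct)
  case base
  then show ?case using f_init big_nonneg by auto
next
  case (step c)
  have p: "par c < c" using par_less step by simp
  show ?case
  proof (cases "x = par c")
    case True
    have "ch c j w = - 1 \<and> f c (par c) j w = f (Suc c) (par c) j w + g c \<or>
      (\<exists>u\<le>w. ch c j w = int u \<and>
         f c (par c) j w = f (Suc c) (par c) j (w - u) + f (Suc c) c j u)"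
      by (rule f_choice) (use step in auto)
    then show ?thesis unfolding True
    proof (elim disjE exE conjE)
      assume "f c (par c) j w = f (Suc c) (par c) j w + g c"
      moreover have "f (Suc c) (par c) j w' \<le> f (Suc c) (par c) j w"
        by (rule step.IH) (use step p in auto)
      moreover have "f c (par c) j w' \<le> f (Suc c) (par c) j w' + g c"
        by (rule f_cut) (use step in auto)
      ultimately show "f c (par c) j w' \<le> f c (par c) j w" by linarith
    next
      fix u assume u: "u \<le> w"
        "f c (par c) j w = f (Suc c) (par c) j (w - u) + f (Suc c) c j u"
      moreover have "f (Suc c) (par c) j (w' - u) \<le> f (Suc c) (par c) j (w - u)"
        by (rule step.IH) (use step p in auto)
      moreover have "f c (par c) j w' \<le> f (Suc c) (par c) j (w' - u) + f (Suc c) c j u"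
        by (rule f_keep) (use step u in auto)
      ultimately show "f c (par c) j w' \<le> f c (par c) j w" by linarith
    qed
  next
    case False
    then show ?thesis using step f_other by simp
  qed
qed

text \<open>
  The partial solution is carried along as a budget \<open>B x\<close> for the part of the block of \<open>x\<close>
  below \<open>x\<close>; the inequality telescopes over the merging steps.
\<close>

lemma g_le_cost:
  assumes K0: "K 0"
    and K: "\<And>c. 0 < c \<Longrightarrow> c < n \<Longrightarrow> K c \<or> blk c = blk (par c)"
    and J: "\<And>x. x < n \<Longrightarrow> J x < n" "\<And>x. x < n \<Longrightarrow> sv x \<le> sv (J x)"
      "\<And>x y. x < n \<Longrightarrow> y < n \<Longrightarrow> blk x = blk y \<Longrightarrow> J x = J y"
    and wt: "\<And>b. (\<Sum>x<n. if blk x = b then wt x else 0) \<le> W"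
  shows "g 0 \<le> (\<Sum>x<n. if K x then sv (J x) else 0)" (is "_ \<le> ?R")
proof -
  let ?L = "\<lambda>c B x. (if K x then sv (J x) else 0) + f c x (J x) (B x)"
  let ?w = "\<lambda>b B x. if blk x = b then B x else (0::nat)"
  have single: "B x \<le> W" if "\<And>b. (\<Sum>x<c. ?w b B x) \<le> W" "x < c" for B c x
  proof -
    have "B x = ?w (blk x) B x" by simp
    also have "\<dots> \<le> (\<Sum>y<c. ?w (blk x) B y)"
      using that(2) by (intro member_le_sum) auto
    finally show ?thesis using that(1)[of "blk x"] by simp
  qed
  have "\<exists>B. (\<forall>b. (\<Sum>x<c. ?w b B x) \<le> W) \<and> (\<Sum>x<c. ?L c B x) \<le> ?R"
    if "c \<le> n" "0 < c" for c
    using that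
  proof (induction c rule: inc_induct)
    case base
    have "wt x \<le> W" if "x < n" for x
      using single[where c = n and B = wt and x = x] wt that by blast
    \<comment> \<open>With the weights as budgets and \<open>J x\<close> bounding the parameter of
      \<open>x\<close>, all initial entries are 0: the sum starts at the cost of the given
      solution.\<close>
    then have "(\<Sum>x<n. ?L n wt x) = ?R"
      using J(1,2) by (intro sum.cong) (auto simp: f_init)
    then show ?case using wt by (intro exI[of _ wt]) auto
  next
    case (step c)
    from step obtain B where B: "\<And>b. (\<Sum>x<Suc c. ?w b B x) \<le> W"
      "(\<Sum>x<Suc c. ?L (Suc c) B x) \<le> ?R" by auto
    let ?p = "par c"
    have p: "?p < c" using par_less step by simp
    have BW: "B x \<le> W" if "x \<le> c" for x
      using single[where c = "Suc c" and B = B and x = x] B(1) that by auto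
    have split: "(\<Sum>x<c. h x) = h ?p + (\<Sum>x\<in>{..<c}-{?p}. h x)"
      for h :: "nat \<Rightarrow> 'z::comm_monoid_add"
      using p by (simp add: sum.remove)
    show ?case
    proof (cases "K c")
      case True
      have "f c ?p (J ?p) (B ?p) \<le> f (Suc c) ?p (J ?p) (B ?p) + g c"
        using step p J(1,2) BW by (intro f_cut) auto
      also have "g c \<le> sv (J c) + f (Suc c) c (J c) W"
        using step J(1,2) by (intro g_le) auto
      also have "f (Suc c) c (J c) W \<le> f (Suc c) c (J c) (B c)"
        using step J(1,2) BW by (intro f_mono) auto
      finally have *: "f c ?p (J ?p) (B ?p) \<le>
        f (Suc c) ?p (J ?p) (B ?p) + (sv (J c) + f (Suc c) c (J c) (B c))" by simp
      have "(\<Sum>x\<in>{..<c}-{?p}. ?L c B x) = (\<Sum>x\<in>{..<c}-{?p}. ?L (Suc c) B x)"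
        using step by (intro sum.cong) (auto simp: f_other)
      with * have "(\<Sum>x<c. ?L c B x) \<le> (\<Sum>x<Suc c. ?L (Suc c) B x)"
        using True by (simp add: split)
      moreover have "(\<Sum>x<c. ?w b B x) \<le> W" for b
        using B(1)[of b] by simp
      ultimately show ?thesis using B(2) by (intro exI[of _ B]) auto
    next
      case False
      \<comment> \<open>The budget of the child moves to its parent. Both lie in one block, so no
        block total changes, and the enlarged budget is still at most \<open>W\<close>.\<close>
      define B' where "B' = B(?p := B ?p + B c)"
      have bl: "blk c = blk ?p" using K[of c] False step by auto
      have Jc: "J ?p = J c" using J(3)[of c ?p] bl step p by auto
      have s1: "(\<Sum>x<c. ?w b B' x) = (\<Sum>x<Suc c. ?w b B x)" for b
      proof -
        have "(\<Sum>x\<in>{..<c}-{?p}. ?w b B' x) = (\<Sum>x\<in>{..<c}-{?p}. ?w b B x)"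
          by (intro sum.cong) (auto simp: B'_def)
        then show ?thesis using bl by (auto simp: split B'_def)
      qed
      then have B'W: "\<And>b. (\<Sum>x<c. ?w b B' x) \<le> W" using B(1) by simp
      have "f c ?p (J ?p) (B' ?p) \<le>
        f (Suc c) ?p (J ?p) (B' ?p - B c) + f (Suc c) c (J ?p) (B c)"
        using step p J(1) single[where c = c and B = B' and x = ?p] B'W by (intro f_keep) (auto simp: B'_def)
      then have *: "f c ?p (J ?p) (B' ?p) \<le>
        f (Suc c) ?p (J ?p) (B ?p) + f (Suc c) c (J c) (B c)"
        by (simp add: B'_def Jc)
      have "(\<Sum>x\<in>{..<c}-{?p}. ?L c B' x) = (\<Sum>x\<in>{..<c}-{?p}. ?L (Suc c) B x)"
        using step by (intro sum.cong) (auto simp: f_other B'_def)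
      with * have "(\<Sum>x<c. ?L c B' x) \<le> (\<Sum>x<Suc c. ?L (Suc c) B x)"
        using False by (simp add: split)
      then show ?thesis using B(2) B'W by (intro exI[of _ B']) auto
    qed
  qed
  from this[of 1] n_pos obtain B where "\<And>b. (\<Sum>x<1. ?w b B x) \<le> W" "(\<Sum>x<1. ?L 1 B x) \<le> ?R"
    by (auto simp del: One_nat_def)
  from this(1)[of "blk 0"] this(2) K0 have B: "B 0 \<le> W" "sv (J 0) + f 1 0 (J 0) (B 0) \<le> ?R"
    by simp_all
  have "g 0 \<le> sv (J 0) + f 1 0 (J 0) W"
    using g_le[of 0 "J 0"] n_pos J(1) by simp
  moreover have "f 1 0 (J 0) W \<le> f 1 0 (J 0) (B 0)"
    using n_pos J(1) B by (intro f_mono) auto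
  ultimately show ?thesis using B by linarith
qed

text \<open>State of the traceback when the nodes below \<open>c\<close> are assigned:
  \<open>J x\<close> is the guessed parameter index, \<open>B x\<close> the budget at which
  \<open>f c x\<close> is to be read, \<open>lab x\<close> the topmost node of the component. The
  clause about \<open>lab (par x)\<close> later yields connectedness. Budgets are bounded per
  component because the final weights will be bounded through them.\<close>

definition traced :: "nat \<Rightarrow> (nat \<Rightarrow> nat) \<Rightarrow> (nat \<Rightarrow> nat) \<Rightarrow> (nat \<Rightarrow> nat) \<Rightarrow> bool" where
  "traced c J B lab \<longleftrightarrow>
     (\<forall>x<c. J x < n \<and> lab x \<le> x \<and> lab (lab x) = lab x \<and> J (lab x) = J x \<and>
        (lab x = x \<or> lab x = lab (par x) \<and> 0 < x)) \<and>
     (\<Sum>x<c. (if lab x = x then sv (J x) else 0) + f c x (J x) (B x)) = g 0 \<and>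
     (\<forall>l. (\<Sum>x<c. if lab x = l then B x else 0) \<le> W)"

lemma traced_budget:
  assumes "traced c J B lab" "x < c"
  shows "B x \<le> W"
proof -
  have "(if lab x = lab x then B x else 0) \<le> (\<Sum>y<c. if lab y = lab x then B y else 0)"
    using assms(2) by (intro member_le_sum) auto
  moreover have "(\<Sum>y<c. if lab y = lab x then B y else 0) \<le> W"
    using assms(1) unfolding traced_def by blast
  ultimately show ?thesis by simp
qed

lemma traced_start:
  assumes "J 0 = bj 0" "B 0 = W" "lab 0 = 0"
  shows "traced 1 J B lab"
  using assms bj_less[OF n_pos] g_eq[OF n_pos] by (auto simp: traced_def)

text \<open>At a cut the entry of the parent loses the summand \<open>g c\<close>, which unfolds to
  the parameter of \<open>bj c\<close> plus the table of \<open>c\<close> at budget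
  \<open>W\<close>: precisely the two terms that the component opened at \<open>c\<close> adds to
  the sum.\<close>

lemma traced_cut:
  assumes t: "traced c J B lab" and c: "0 < c" "c < n"
    and cut: "ch c (J (par c)) (B (par c)) = - 1"
  shows "traced (Suc c) (J(c := bj c)) (B(c := W)) (lab(c := c))"
proof -
  let ?p = "par c"
  have p: "?p < c" using par_less c by simp
  have I: "J x < n" "lab x \<le> x" "lab (lab x) = lab x" "J (lab x) = J x"
    "lab x = x \<or> lab x = lab (par x) \<and> 0 < x" if "x < c" for x
    using t that unfolding traced_def by auto
  have par': "par x < c" if "x < c" "0 < x" for x
    using par_less[of x] that c by simp
  have lab': "lab x < c" if "x < c" for x
    using I(2)[OF that] that by simp
  have split: "(\<Sum>x<c. h x) = h ?p + (\<Sum>x\<in>{..<c}-{?p}. h x)" for h :: "nat \<Rightarrow> real"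
    using p by (simp add: sum.remove)
  let ?J = "J(c := bj c)" and ?B = "B(c := W)" and ?l = "lab(c := c)"
  have B: "B ?p \<le> W" using traced_budget[OF t p] .
  have "f c ?p (J ?p) (B ?p) = f (Suc c) ?p (J ?p) (B ?p) + g c"
    using f_choice[of c "J ?p" "B ?p"] cut c B I(1)[OF p] by auto
  then have 1: "f c ?p (J ?p) (B ?p) =
      f (Suc c) ?p (J ?p) (B ?p) + (sv (bj c) + f (Suc c) c (bj c) W)"
    using g_eq c by simp
  let ?L = "\<lambda>c J B lab x. (if lab x = x then sv (J x) else 0) + f c x (J x) (B x)"
  have 2: "(\<Sum>x\<in>{..<c}-{?p}. ?L (Suc c) ?J ?B ?l x) = (\<Sum>x\<in>{..<c}-{?p}. ?L c J B lab x)"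
    using c by (intro sum.cong) (auto simp: f_other)
  have "(\<Sum>x<Suc c. ?L (Suc c) ?J ?B ?l x) = (\<Sum>x<c. ?L c J B lab x)"
    using 1 2 p by (simp add: split)
  then have B3: "(\<Sum>x<Suc c. ?L (Suc c) ?J ?B ?l x) = g 0"
    using t by (simp add: traced_def)
  have C3: "(\<Sum>x<Suc c. if ?l x = l then ?B x else 0) \<le> W" for l
  proof -
    have *: "(\<Sum>x<c. if ?l x = l then ?B x else 0) = (\<Sum>x<c. if lab x = l then B x else 0)"
      by (intro sum.cong) auto
    show ?thesis
    proof (cases "l = c")
      case True
      have "(\<Sum>x<c. if lab x = l then B x else 0) = 0"
        using lab' True by (intro sum.neutral) auto
      then show ?thesis using True * by simp
    next
      case False
      then show ?thesis using * t by (simp add: traced_def)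
    qed
  qed
  have A3: "?J x < n \<and> ?l x \<le> x \<and> ?l (?l x) = ?l x \<and> ?J (?l x) = ?J x \<and>
      (?l x = x \<or> ?l x = ?l (par x) \<and> 0 < x)" if "x < Suc c" for x
  proof (cases "x = c")
    case True
    then show ?thesis using bj_less c by simp
  next
    case False
    then have x: "x < c" using that by simp
    then have "lab x \<noteq> c" "0 < x \<Longrightarrow> par x \<noteq> c"
      using lab'[of x] par'[of x] by auto
    then show ?thesis using I[OF x] x False by auto
  qed
  show ?thesis
    unfolding traced_def
    by (rule conjI[OF _ conjI]) (rule allI impI A3 B3 C3 | assumption)+
qed

text \<open>The recorded \<open>u\<close> splits the budget of the parent, and child and parent
  share a label, so all totals stay the same. The second conclusion makes the subtraction of natural
  numbers agree with the one performed on machine integers.\<close>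

lemma traced_keep:
  assumes t: "traced c J B lab" and c: "0 < c" "c < n"
    and keep: "ch c (J (par c)) (B (par c)) = int u"
  shows "traced (Suc c) (J(c := J (par c))) (B(c := u, par c := B (par c) - u))
    (lab(c := lab (par c)))" "u \<le> B (par c)"
proof -
  let ?p = "par c"
  have p: "?p < c" using par_less c by simp
  have I: "J x < n" "lab x \<le> x" "lab (lab x) = lab x" "J (lab x) = J x"
    "lab x = x \<or> lab x = lab (par x) \<and> 0 < x" if "x < c" for x
    using t that unfolding traced_def by auto
  have par': "par x < c" if "x < c" "0 < x" for x
    using par_less[of x] that c by simp
  have lab': "lab x < c" if "x < c" for x
    using I(2)[OF that] that by simp
  have split: "(\<Sum>x<c. h x) = h ?p + (\<Sum>x\<in>{..<c}-{?p}. h x)"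
    for h :: "nat \<Rightarrow> 'z::comm_monoid_add"
    using p by (simp add: sum.remove)
  let ?J = "J(c := J ?p)" and ?B = "B(c := u, ?p := B ?p - u)" and ?l = "lab(c := lab ?p)"
  have B: "B ?p \<le> W" using traced_budget[OF t p] .
  have 1: "u \<le> B ?p \<and> f c ?p (J ?p) (B ?p) =
      f (Suc c) ?p (J ?p) (B ?p - u) + f (Suc c) c (J ?p) u"
    using f_choice[of c "J ?p" "B ?p"] keep c B I(1)[OF p] by auto
  then show "u \<le> B ?p" by simp
  let ?L = "\<lambda>c J B lab x. (if lab x = x then sv (J x) else 0) + f c x (J x) (B x)"
  have 2: "(\<Sum>x\<in>{..<c}-{?p}. ?L (Suc c) ?J ?B ?l x) = (\<Sum>x\<in>{..<c}-{?p}. ?L c J B lab x)"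
    using c by (intro sum.cong) (auto simp: f_other)
  have "lab ?p \<noteq> c" using lab'[OF p] by simp
  then have "(\<Sum>x<Suc c. ?L (Suc c) ?J ?B ?l x) = (\<Sum>x<c. ?L c J B lab x)"
    using 1 2 p by (simp add: split)
  then have B3: "(\<Sum>x<Suc c. ?L (Suc c) ?J ?B ?l x) = g 0"
    using t by (simp add: traced_def)
  have C3: "(\<Sum>x<Suc c. if ?l x = l then ?B x else 0) \<le> W" for l
  proof -
    have "(\<Sum>x\<in>{..<c}-{?p}. if ?l x = l then ?B x else 0) =
        (\<Sum>x\<in>{..<c}-{?p}. if lab x = l then B x else 0)"
      by (intro sum.cong) auto
    then have "(\<Sum>x<Suc c. if ?l x = l then ?B x else 0) = (\<Sum>x<c. if lab x = l then B x else 0)"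
      using 1 p by (auto simp: split)
    then show ?thesis using t by (simp add: traced_def)
  qed
  have A3: "?J x < n \<and> ?l x \<le> x \<and> ?l (?l x) = ?l x \<and> ?J (?l x) = ?J x \<and>
      (?l x = x \<or> ?l x = ?l (par x) \<and> 0 < x)" if "x < Suc c" for x
  proof (cases "x = c")
    case True
    have "lab ?p \<noteq> c" "lab ?p \<le> c" using lab'[OF p] by auto
    then show ?thesis using True I[OF p] p c by auto
  next
    case False
    then have x: "x < c" using that by simp
    then have "lab x \<noteq> c" "0 < x \<Longrightarrow> par x \<noteq> c"
      using lab'[of x] par'[of x] by auto
    then show ?thesis using I[OF x] x False by auto
  qed
  show "traced (Suc c) ?J ?B ?l"
    unfolding traced_def
    by (rule conjI[OF _ conjI]) (rule allI impI A3 B3 C3 | assumption)+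
qed

text \<open>The summands are nonnegative and add up to less than \<open>big\<close>, so no initial
  entry equals \<open>big\<close>. Hence all of them are 0, which by \<open>f_init\<close> means
  that the guesses respect every weight and parameter, and only the prices of the opened components
  remain.\<close>

lemma traced_end:
  assumes t: "traced n J B lab" and small: "g 0 < big"
  shows "\<And>x. x < n \<Longrightarrow> sv x \<le> sv (J x)"
    and "\<And>l. (\<Sum>x<n. if lab x = l then wt x else 0) \<le> W"
    and "(\<Sum>x<n. if lab x = x then sv (J x) else 0) = g 0"
proof -
  let ?L = "\<lambda>x. (if lab x = x then sv (J x) else 0) + f n x (J x) (B x)"
  have J: "J x < n" and B: "B x \<le> W" if "x < n" for x
    using t that traced_budget[OF t that] unfolding traced_def by blast+
  have nonneg: "0 \<le> ?L x" if "x < n" for x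
    using f_nonneg[OF order.refl n_pos that J[OF that] B[OF that]] sv_nonneg[OF J[OF that]]
    by (cases "lab x = x") simp_all
  have ok: "wt x \<le> B x \<and> sv x \<le> sv (J x)" if x: "x < n" for x
  proof -
    have "f n x (J x) (B x) \<le> ?L x"
      using sv_nonneg J x by simp
    also have "\<dots> \<le> (\<Sum>x<n. ?L x)"
      using x nonneg by (intro member_le_sum) auto
    also have "\<dots> < big" using t small by (simp add: traced_def)
    finally show ?thesis using f_init[of x "J x" "B x"] x J B by (auto split: if_splits)
  qed
  then show "\<And>x. x < n \<Longrightarrow> sv x \<le> sv (J x)" by blast
  show "(\<Sum>x<n. if lab x = l then wt x else 0) \<le> W" for l
  proof -
    have "(\<Sum>x<n. if lab x = l then wt x else 0) \<le> (\<Sum>x<n. if lab x = l then B x else 0)"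
      using ok by (intro sum_mono) auto
    moreover have "(\<Sum>x<n. if lab x = l then B x else 0) \<le> W"
      using t unfolding traced_def by blast
    ultimately show ?thesis by linarith
  qed
  have "(\<Sum>x<n. ?L x) = (\<Sum>x<n. if lab x = x then sv (J x) else 0)"
    using ok J B by (intro sum.cong) (auto simp: f_init)
  then show "(\<Sum>x<n. if lab x = x then sv (J x) else 0) = g 0"
    using t by (simp add: traced_def)
qed

end

section \<open>Search orders of trees and optimality\<close>

text \<open>\<open>par\<close> acts on positions, not on vertices. The length \<open>k\<close> is a
  parameter so that prefixes and the unfinished enumerations met during exploration are instances as
  well.\<close>

definition search_order ::
    "'a set \<Rightarrow> 'a set set \<Rightarrow> nat \<Rightarrow> (nat \<Rightarrow> 'a) \<Rightarrow> (nat \<Rightarrow> nat) \<Rightarrow> bool" where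
  "search_order V E k ord par \<longleftrightarrow> 0 < k \<and> inj_on ord {..<k} \<and> ord ` {..<k} \<subseteq> V \<and>
     (\<forall>c. 0 < c \<and> c < k \<longrightarrow> par c < c \<and> {ord c, ord (par c)} \<in> E)"

lemma search_order_less:
  assumes "search_order V E n ord par" "k \<le> n" "0 < k"
  shows "search_order V E k ord par"
  using assms unfolding search_order_def inj_on_def by fastforce

text \<open>Induction on the prefix: a path from or to the last vertex is a path of the shorter
  prefix from or to its parent, extended by one edge. The last vertex does not occur earlier, which
  keeps the path simple.\<close>

lemma search_order_path:
  assumes "search_order V E k ord par" "x < k" "y < k"
  shows "\<exists>xs. xs \<noteq> [] \<and> distinct xs \<and> hd xs = ord x \<and> last xs = ord y \<and>
    set xs \<subseteq> ord ` {..<k} \<and> successively (\<lambda>u v. {u, v} \<in> E) xs"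
  using assms
proof (induction k arbitrary: x y)
  case 0
  then show ?case by simp
next
  case (Suc k)
  let ?adj = "\<lambda>u v. {u, v} \<in> E"
  let ?path = "\<lambda>k x y xs. xs \<noteq> [] \<and> distinct xs \<and> hd xs = ord x \<and> last xs = ord y \<and>
    set xs \<subseteq> ord ` {..<k} \<and> successively ?adj xs"
  have inj: "inj_on ord {..<Suc k}" using Suc.prems by (simp add: search_order_def)
  have new: "ord k \<notin> ord ` {..<k}"
    using inj by (force dest: inj_onD)
  consider "x = y" | "x < k" "y < k" | "x = k" "y < k" | "x < k" "y = k"
    using Suc.prems by linarith
  then show ?case
  proof cases
    case 1
    then show ?thesis using Suc.prems by (intro exI[of _ "[ord x]"]) auto
  next
    case 2
    then have "search_order V E k ord par"
      using Suc.prems(1) search_order_less[of V E "Suc k"] by simp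
    then obtain xs where "?path k x y xs" using Suc.IH 2 by blast
    then show ?thesis by (intro exI[of _ xs]) auto
  next
    case 3
    then have p: "par k < k" "?adj (ord k) (ord (par k))"
      using Suc.prems(1) by (auto simp: search_order_def)
    have "search_order V E k ord par"
      using Suc.prems(1) search_order_less[of V E "Suc k"] p by simp
    then obtain xs where "?path k (par k) y xs" using Suc.IH 3 p by blast
    then show ?thesis using 3 p new
      by (intro exI[of _ "ord k # xs"]) (auto simp: successively_Cons)
  next
    case 4
    then have p: "par k < k" "?adj (ord (par k)) (ord k)"
      using Suc.prems(1) by (auto simp: search_order_def insert_commute)
    have "search_order V E k ord par"
      using Suc.prems(1) search_order_less[of V E "Suc k"] p by simp
    then obtain xs where "?path k x (par k) xs" using Suc.IH 4 p by blast
    then show ?thesis using 4 p new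
      by (intro exI[of _ "xs @ [ord k]"]) (auto simp: successively_append_iff)
  qed
qed

text \<open>Any edge that is not a parent edge would close a cycle.\<close>

lemma search_order_edge:
  assumes E: "is_tree V E" and so: "search_order V E k ord par"
    and xy: "x < y" "y < k" "{ord x, ord y} \<in> E"
  shows "x = par y"
proof (rule ccontr)
  assume ne: "x \<noteq> par y"
  have p: "par y < y" "{ord y, ord (par y)} \<in> E"
    using so xy by (auto simp: search_order_def)
  have inj: "inj_on ord {..<k}" using so by (simp add: search_order_def)
  have "search_order V E y ord par"
    using search_order_less[OF so, of y] xy by simp
  from search_order_path[OF this xy(1) p(1)] obtain xs where xs: "xs \<noteq> []" "distinct xs"
    "hd xs = ord x" "last xs = ord (par y)" "set xs \<subseteq> ord ` {..<y}"
    "successively (\<lambda>u v. {u, v} \<in> E) xs" by blast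
  have "ord y \<notin> set xs"
    using xs(5) inj xy(2) by (force simp: inj_on_def)
  have "ord x \<noteq> ord (par y)"
    using inj ne xy p by (auto simp: inj_on_def)
  \<comment> \<open>Distinct ends give two vertices on the path; \<open>ord y\<close> is the third
    that a cycle requires.\<close>
  then have "2 \<le> length xs"
    using xs by (cases xs; cases "tl xs") auto
  then have "is_cycle E (xs @ [ord y])"
    using xs \<open>ord y \<notin> set xs\<close> p xy(3)
    by (auto simp: is_cycle_def successively_append_iff insert_commute)
  then show False using E by (auto simp: is_tree_def)
qed

text \<open>Both ends of an edge have positions, and the earlier one must be the parent of the later
  one. From here on connectedness can be argued through \<open>par\<close> alone.\<close>

lemma tree_edges_eq:
  assumes E: "is_tree V E" and so: "search_order V E n ord par" and V: "V = ord ` {..<n}"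
  shows "E = (\<lambda>c. {ord c, ord (par c)}) ` {1..<n}"
proof
  show "(\<lambda>c. {ord c, ord (par c)}) ` {1..<n} \<subseteq> E"
    using so by (auto simp: search_order_def)
  show "E \<subseteq> (\<lambda>c. {ord c, ord (par c)}) ` {1..<n}"
  proof
    fix e assume e: "e \<in> E"
    then have "e \<subseteq> V" "card e = 2"
      using E by (auto simp: is_tree_def simple_graph_def)
    then obtain x y where xy: "e = {ord x, ord y}" "ord x \<noteq> ord y" "x < n" "y < n"
      using V by (auto simp: card_2_iff)
    then have "x < y \<or> y < x" by (metis linorder_neqE_nat)
    then show "e \<in> (\<lambda>c. {ord c, ord (par c)}) ` {1..<n}"
      using search_order_edge[OF E so, of x y] search_order_edge[OF E so, of y x] e xy
      by (auto simp: insert_commute image_iff intro: bexI[of _ x] bexI[of _ y])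
  qed
qed

lemma connected_nodes_closed:
  assumes "connected_nodes E V" "S \<subseteq> V" "s \<in> S"
    and closed: "\<And>u v. u \<in> S \<Longrightarrow> v \<in> V \<Longrightarrow> {u, v} \<in> E \<Longrightarrow> v \<in> S"
  shows "S = V"
proof -
  have "v \<in> S" if "v \<in> V" for v
  proof -
    have "(s, v) \<in> {(x, y). x \<in> V \<and> y \<in> V \<and> {x, y} \<in> E}\<^sup>*"
      using assms(1-3) that unfolding connected_nodes_def by blast
    then show ?thesis
      by induction (use closed assms(3) in auto)
  qed
  then show ?thesis using assms(2) by blast
qed

text \<open>A connected set has a single topmost vertex. Let \<open>t\<close> be its least position
  and consider the vertices of \<open>C\<close> that reach \<open>t\<close> by climbing parents
  inside \<open>C\<close>. They are closed under edges, hence exhaust \<open>C\<close>, and the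
  first step of the climb shows the parent of any other vertex to be in \<open>C\<close>. So a block
  of a feasible partition is opened only once.\<close>

lemma connected_nodes_parent:
  assumes C: "connected_nodes E C" "C \<subseteq> ord ` {..<n}"
    and E: "E = (\<lambda>c. {ord c, ord (par c)}) ` {1..<n}"
    and so: "search_order V E n ord par"
  shows "\<exists>t<n. \<forall>x<n. ord x \<in> C \<longrightarrow> x \<noteq> t \<longrightarrow> 0 < x \<and> ord (par x) \<in> C"
proof -
  let ?X = "{x. x < n \<and> ord x \<in> C}"
  let ?A = "{(x, par x) | x. 0 < x \<and> x \<in> ?X \<and> par x \<in> ?X}"
  define t where "t = Min ?X"
  have inj: "inj_on ord {..<n}" using so by (simp add: search_order_def)
  have par: "par x < x" if "0 < x" "x < n" for x
    using so that by (simp add: search_order_def)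
  have "?X \<noteq> {}" using C by (auto simp: connected_nodes_def)
  then have t: "t \<in> ?X" and min: "\<And>x. x \<in> ?X \<Longrightarrow> t \<le> x"
    unfolding t_def using Min_in[of ?X] Min_le[of ?X] by auto
  let ?S = "ord ` {x \<in> ?X. (x, t) \<in> ?A\<^sup>*}"
  have S: "?S = C"
  proof (rule connected_nodes_closed[OF C(1)])
    show "?S \<subseteq> C" by auto
    show "ord t \<in> ?S" using t by auto
    fix u v assume "u \<in> ?S" and v: "v \<in> C" "{u, v} \<in> E"
    then obtain x where x: "x \<in> ?X" "(x, t) \<in> ?A\<^sup>*" "u = ord x" by blast
    obtain y where y: "y \<in> ?X" "v = ord y" using v C(2) by auto
    have "{ord x, ord y} \<in> (\<lambda>c. {ord c, ord (par c)}) ` {1..<n}"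
      using v x y E by simp
    then obtain c where "c \<in> {1..<n}" and "{ord x, ord y} = {ord c, ord (par c)}"
      by blast
    then have c: "0 < c" "c < n" "{ord x, ord y} = {ord c, ord (par c)}"
      by auto
    then have "x = c \<and> y = par c \<or> x = par c \<and> y = c"
      using inj par[of c] x y by (auto simp: doubleton_eq_iff inj_on_def)
    then have "(y, t) \<in> ?A\<^sup>*"
    proof
      assume a: "x = c \<and> y = par c"
      \<comment> \<open>\<open>y\<close> is the parent of \<open>x\<close>, hence smaller, so
        \<open>x\<close> is not the minimum and its climb begins with the step to
        \<open>y\<close>.\<close>
      then have "x \<noteq> t" using min[of y] par[of c] c y by auto
      then obtain z where "(x, z) \<in> ?A" "(z, t) \<in> ?A\<^sup>*"
        using x(2) by (meson converse_rtranclE)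
      then show ?thesis using a by auto
    next
      assume "x = par c \<and> y = c"
      then have "(y, x) \<in> ?A" using x y c by auto
      then show ?thesis using x(2) by (meson converse_rtrancl_into_rtrancl)
    qed
    then show "v \<in> ?S" using y by auto
  qed
  have "0 < x \<and> ord (par x) \<in> C" if x: "x < n" "ord x \<in> C" "x \<noteq> t" for x
  proof -
    have "ord x \<in> ?S" unfolding S by (fact x(2))
    then obtain y where y: "y < n" "ord y = ord x" "(y, t) \<in> ?A\<^sup>*"
      by (elim imageE CollectE conjE) (rule that, auto)
    then have "y = x" using inj x by (auto simp: inj_on_def)
    then obtain z where "(x, z) \<in> ?A"
      using y(3) x(3) by (meson converse_rtranclE)
    then show ?thesis by auto
  qed
  then show ?thesis using t by blast
qed

section \<open>Optimality for instances of the tree partition problem\<close>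

locale tree_partition_dp =
  partition_dp n W par wt sv big f g bj ch
  for n W par wt sv big f g bj ch +
  fixes I :: tree_partition and ord :: "nat \<Rightarrow> nat"
  assumes valid: "valid_instance I"
    and order: "search_order (nodes I) (edges I) n ord par"
    and nodes_eq: "nodes I = ord ` {..<n}"
    and wt_eq: "\<And>x. x < n \<Longrightarrow> real (wt x) = weight I (ord x)"
    and sv_eq: "\<And>x. x < n \<Longrightarrow> sv x = param I (ord x)"
    and W_eq: "real W \<le> threshold I" "threshold I < real W + 1"
    and big_eq: "(\<Sum>x<n. sv x) < big"
begin

lemma inj_ord: "inj_on ord {..<n}"
  using order by (simp add: search_order_def)

lemma edges_eq: "edges I = (\<lambda>c. {ord c, ord (par c)}) ` {1..<n}"
  using tree_edges_eq[OF _ order nodes_eq] valid by (simp add: valid_instance_def)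

lemma param_nonneg: "i \<in> nodes I \<Longrightarrow> 0 \<le> param I i"
  using valid by (simp add: valid_instance_def)

lemma finite_nodes: "finite (nodes I)"
  by (simp add: nodes_eq)

lemma cost_nonneg_block:
  assumes "C \<subseteq> nodes I" "C \<noteq> {}"
  shows "0 \<le> Max (param I ` C)"
proof -
  have "finite C" using assms(1) finite_nodes by (rule finite_subset)
  moreover obtain i where "i \<in> C" using assms(2) by blast
  moreover from this have "0 \<le> param I i" using assms param_nonneg by blast
  ultimately show ?thesis by (meson Max_ge finite_imageI imageI order_trans)
qed

text \<open>Supplies the data for \<open>g_le_cost\<close>: a node opens its block iff it is the
  root or its parent lies in another block, and \<open>arg\<close> picks a node where the block
  attains its maximum. As each block has one topmost node, the opening prices form a subsum of the
  nonnegative summands of the cost.\<close>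

lemma lower_bound:
  assumes P: "feasible I P"
  shows "g 0 \<le> cost I P"
proof -
  have part: "partition_on (nodes I) P" using P by (simp add: feasible_def)
  then have fin: "finite P" using finite_nodes finite_elements by blast
  have sub: "C \<subseteq> nodes I" if "C \<in> P" for C
    using part that by (auto simp: partition_on_def)
  define blk where "blk x = (THE C. C \<in> P \<and> ord x \<in> C)" for x
  have ex1: "\<exists>!C. C \<in> P \<and> ord x \<in> C" if "x < n" for x
  proof -
    have "ord x \<in> \<Union>P" using part nodes_eq that by (auto simp: partition_on_def)
    moreover have "C = D" if "C \<in> P" "D \<in> P" "ord x \<in> C" "ord x \<in> D" for C D
      using part that unfolding partition_on_def by (meson disjointD disjoint_iff)
    ultimately show ?thesis by blast
  qed
  have blk: "blk x \<in> P" "ord x \<in> blk x" if "x < n" for x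
    using theI'[OF ex1[OF that]] by (auto simp: blk_def)
  have blk_eq: "blk x = C" if "x < n" "C \<in> P" "ord x \<in> C" for x C
    using ex1[OF that(1)] blk[OF that(1)] that by blast
  define arg where "arg C = (SOME j. j < n \<and> ord j \<in> C \<and> param I (ord j) = Max (param I ` C))" for C
  have arg: "arg C < n \<and> ord (arg C) \<in> C \<and> param I (ord (arg C)) = Max (param I ` C)"
    if C: "C \<in> P" for C
  proof -
    have "C \<noteq> {}" "finite C"
      using part C sub[OF C] finite_nodes finite_subset by (auto simp: partition_on_def)
    then obtain i where "i \<in> C" "param I i = Max (param I ` C)"
      by (metis (mono_tags, lifting) Max_in finite_imageI imageE image_is_empty)
    moreover from this obtain j where "j < n" "i = ord j"
      using sub[OF C] nodes_eq by auto
    ultimately have "j < n \<and> ord j \<in> C \<and> param I (ord j) = Max (param I ` C)"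
      by simp
    then show ?thesis unfolding arg_def by (rule someI)
  qed
  let ?K = "\<lambda>x. x = 0 \<or> blk x \<noteq> blk (par x)" and ?J = "\<lambda>x. arg (blk x)"
  have "g 0 \<le> (\<Sum>x<n. if ?K x then sv (?J x) else 0)"
  proof (rule g_le_cost)
    show "arg (blk x) < n" if "x < n" for x using arg blk that by blast
    show "sv x \<le> sv (arg (blk x))" if "x < n" for x
    proof -
      have "finite (blk x)" using sub blk that finite_nodes by (meson finite_subset)
      then have "param I (ord x) \<le> Max (param I ` blk x)"
        using blk[OF that] by (intro Max_ge) auto
      then show ?thesis using arg[OF blk(1)[OF that]] that by (simp add: sv_eq)
    qed
    show "(\<Sum>x<n. if blk x = b then wt x else 0) \<le> W" for b
    proof (cases "b \<in> P")
      case True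
      have "real (\<Sum>x<n. if blk x = b then wt x else 0) = (\<Sum>x<n. if blk x = b then weight I (ord x) else 0)"
        unfolding of_nat_sum by (intro sum.cong) (auto simp: wt_eq)
      also have "\<dots> = (\<Sum>x\<in>{x\<in>{..<n}. blk x = b}. weight I (ord x))"
        by (rule sum.inter_filter[symmetric]) simp
      also have "\<dots> = (\<Sum>i\<in>ord ` {x\<in>{..<n}. blk x = b}. weight I i)"
        using inj_ord by (subst sum.reindex) (auto simp: inj_on_def)
      also have "ord ` {x\<in>{..<n}. blk x = b} = b"
      proof
        show "ord ` {x\<in>{..<n}. blk x = b} \<subseteq> b" using blk by auto
        show "b \<subseteq> ord ` {x\<in>{..<n}. blk x = b}"
        proof
          fix i assume "i \<in> b"
          moreover from this obtain x where "x < n" "i = ord x"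
            using sub[OF True] nodes_eq by auto
          ultimately show "i \<in> ord ` {x\<in>{..<n}. blk x = b}"
            using blk_eq True by auto
        qed
      qed
      also have "(\<Sum>i\<in>b. weight I i) \<le> threshold I"
        using P True by (simp add: feasible_def)
      \<comment> \<open>Passage from the real threshold to \<open>W\<close>: a natural number below
        \<open>real W + 1\<close> is at most \<open>W\<close>.\<close>
      finally have "real (\<Sum>x<n. if blk x = b then wt x else 0) < real W + 1"
        using W_eq by linarith
      then show ?thesis by linarith
    next
      case False
      then have "(\<Sum>x<n. if blk x = b then wt x else 0) = 0"
        using blk by (intro sum.neutral) auto
      then show ?thesis by simp
    qed
  qed auto
  also have "\<dots> = (\<Sum>x\<in>{x\<in>{..<n}. ?K x}. sv (?J x))"
    by (rule sum.inter_filter[symmetric]) simp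
  also have "\<dots> = (\<Sum>x\<in>{x\<in>{..<n}. ?K x}. Max (param I ` blk x))"
    using arg blk by (intro sum.cong) (auto simp: sv_eq)
  also have "\<dots> = (\<Sum>C\<in>blk ` {x\<in>{..<n}. ?K x}. Max (param I ` C))"
  proof (subst sum.reindex)
    show "inj_on blk {x\<in>{..<n}. ?K x}"
    proof (rule inj_onI)
      fix x y assume xy: "x \<in> {x\<in>{..<n}. ?K x}" "y \<in> {x\<in>{..<n}. ?K x}" "blk x = blk y"
      then have P: "blk x \<in> P" using blk by auto
      then have "connected_nodes (edges I) (blk x)" "blk x \<subseteq> ord ` {..<n}"
        using \<open>feasible I P\<close> sub nodes_eq by (auto simp: feasible_def)
      from connected_nodes_parent[OF this edges_eq order] obtain t
        where t: "\<And>z. z < n \<Longrightarrow> ord z \<in> blk x \<Longrightarrow> z \<noteq> t \<Longrightarrow> 0 < z \<and> ord (par z) \<in> blk x"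
        by blast
      have "z = t" if z: "z < n" "blk z = blk x" "?K z" for z
      proof (rule ccontr)
        assume "z \<noteq> t"
        then have *: "0 < z" "ord (par z) \<in> blk x"
          using t[of z] blk(2)[of z] z by auto
        then have "par z < n" using par_less[of z] z by simp
        then show False using blk_eq[of "par z" "blk x"] P * z by auto
      qed
      then show "x = y" using xy by auto
    qed
  qed simp
  also have "\<dots> \<le> (\<Sum>C\<in>P. Max (param I ` C))"
  proof (rule sum_mono2[OF fin])
    show "blk ` {x\<in>{..<n}. ?K x} \<subseteq> P" using blk by auto
    show "0 \<le> Max (param I ` C)" if "C \<in> P - blk ` {x\<in>{..<n}. ?K x}" for C
      using that part sub by (intro cost_nonneg_block) (auto simp: partition_on_def)
  qed
  finally show ?thesis by (simp add: cost_def)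
qed

text \<open>With nonnegative parameters a maximum is at most the sum over its block, and the blocks
  are disjoint.\<close>

lemma cost_less_big:
  assumes P: "feasible I P"
  shows "cost I P < big"
proof -
  have part: "partition_on (nodes I) P" using P by (simp add: feasible_def)
  then have fin: "finite P" using finite_nodes finite_elements by blast
  have sub: "C \<subseteq> nodes I" "C \<noteq> {}" if "C \<in> P" for C
    using part that by (auto simp: partition_on_def)
  have finC: "finite C" if "C \<in> P" for C
    using sub(1)[OF that] finite_nodes by (rule finite_subset)
  have "cost I P \<le> (\<Sum>C\<in>P. \<Sum>i\<in>C. param I i)"
    unfolding cost_def
  proof (rule sum_mono)
    fix C assume C: "C \<in> P"
    then have "Max (param I ` C) \<in> param I ` C"
      using sub[OF C] finC[OF C] by (intro Max_in) auto
    then obtain i where i: "i \<in> C" "Max (param I ` C) = param I i" by auto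
    have "param I i \<le> (\<Sum>i\<in>C. param I i)"
      using sub[OF C] finC[OF C] i param_nonneg by (intro member_le_sum) auto
    then show "Max (param I ` C) \<le> (\<Sum>i\<in>C. param I i)" using i by simp
  qed
  also have "\<dots> = (\<Sum>i\<in>\<Union>P. param I i)"
    using finC part by (subst sum.Union_disjoint) (auto simp: partition_on_def disjoint_def)
  also have "\<dots> = (\<Sum>x<n. param I (ord x))"
    using part inj_ord by (simp add: partition_on_def nodes_eq sum.reindex)
  also have "\<dots> = (\<Sum>x<n. sv x)" by (simp add: sv_eq)
  finally show ?thesis using big_eq by simp
qed

text \<open>The cost is only bounded from above, since a guessed parameter might exceed the true
  maximum; equality follows later from \<open>lower_bound\<close>. A block is connected because each
  of its nodes reaches the node named by its label along parents that carry the same label.\<close>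

lemma traced_partition:
  fixes label :: "nat \<Rightarrow> int"
  assumes t: "traced n J B lab" and small: "g 0 < big"
    and label: "\<And>x. x < n \<Longrightarrow> label (ord x) = int (lab x)"
  defines "P \<equiv> (\<lambda>i. {j \<in> nodes I. label j = label i}) ` nodes I"
  shows "feasible I P" "cost I P \<le> g 0"
proof -
  have tr: "J x < n" "lab x \<le> x" "lab (lab x) = lab x" "J (lab x) = J x"
    "lab x = x \<or> lab x = lab (par x) \<and> 0 < x" if "x < n" for x
    using t that unfolding traced_def by blast+
  define T where "T = {x \<in> {..<n}. lab x = x}"
  define F where "F l = ord ` {x \<in> {..<n}. lab x = l}" for l
  have P: "P = F ` T"
  proof -
    have *: "{j \<in> nodes I. label j = label (ord x)} = F (lab x)" if "x < n" for x
      using label that by (auto simp: F_def nodes_eq)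
    then have "P = (\<lambda>x. F (lab x)) ` {..<n}"
      unfolding P_def by (simp add: nodes_eq image_image)
    also have "\<dots> = F ` T"
    proof -
      have "lab ` {..<n} = T"
      proof
        show "lab ` {..<n} \<subseteq> T"
          using tr by (force simp: T_def intro: le_less_trans)
        show "T \<subseteq> lab ` {..<n}" by (force simp: T_def image_iff)
      qed
      then show ?thesis by (metis image_image)
    qed
    finally show ?thesis .
  qed
  have conn: "connected_nodes (edges I) (F l)" if l: "l \<in> T" for l
  proof -
    let ?R = "{(x, y). x \<in> F l \<and> y \<in> F l \<and> {x, y} \<in> edges I}"
    have root: "(ord x, ord l) \<in> ?R\<^sup>*" if "x < n" "lab x = l" for x
      using that
    proof (induction x rule: less_induct)
      case (less x)
      show ?case
      proof (cases "lab x = x")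
        case False
        then have x: "lab (par x) = l" "0 < x" using tr(5)[of x] less.prems by auto
        have p: "par x < x" using par_less less.prems x by simp
        have "(ord x, ord (par x)) \<in> ?R"
          using x p less.prems by (auto simp: F_def edges_eq)
        moreover have "(ord (par x), ord l) \<in> ?R\<^sup>*"
          using less.IH[OF p] p less.prems x by simp
        ultimately show ?thesis by (rule converse_rtrancl_into_rtrancl)
      qed (use less.prems in simp)
    qed
    have "sym ?R" by (auto simp: sym_def insert_commute)
    then have "sym (?R\<^sup>*)" by (rule sym_rtrancl)
    then have "(u, v) \<in> ?R\<^sup>*" if "u \<in> F l" "v \<in> F l" for u v
      using root that unfolding F_def by (smt (verit) imageE mem_Collect_eq lessThan_iff rtrancl_trans symD)
    moreover have "F l \<noteq> {}" using l by (auto simp: F_def T_def)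
    ultimately show ?thesis by (auto simp: connected_nodes_def)
  qed
  have "partition_on (nodes I) P"
    unfolding P_def partition_on_def disjoint_def by auto
  moreover have "(\<Sum>i\<in>F l. weight I i) \<le> threshold I" for l
  proof -
    have "(\<Sum>i\<in>F l. weight I i) = (\<Sum>x\<in>{x\<in>{..<n}. lab x = l}. weight I (ord x))"
      unfolding F_def using inj_ord by (subst sum.reindex) (auto simp: inj_on_def)
    also have "\<dots> = (\<Sum>x<n. if lab x = l then weight I (ord x) else 0)"
      by (rule sum.inter_filter) simp
    also have "\<dots> = real (\<Sum>x<n. if lab x = l then wt x else 0)"
      unfolding of_nat_sum by (intro sum.cong) (auto simp: wt_eq)
    also have "\<dots> \<le> real W"
      using traced_end(2)[OF t small] by (rule of_nat_mono)
    finally show ?thesis using W_eq by linarith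
  qed
  ultimately show "feasible I P"
    using conn unfolding feasible_def P by auto
  have FT: "F l \<subseteq> nodes I" "F l \<noteq> {}" "finite (F l)" if "l \<in> T" for l
    using that by (auto simp: F_def T_def nodes_eq)
  have "cost I P = (\<Sum>C\<in>F ` T. Max (param I ` C))"
    by (simp add: cost_def P)
  \<comment> \<open>Nonnegative block costs allow passing from the image to the index set by an
    inequality, without injectivity of \<open>F\<close>.\<close>
  also have "\<dots> \<le> (\<Sum>l\<in>T. Max (param I ` F l))"
    using sum_image_le[of T "\<lambda>C. Max (param I ` C)" F] FT cost_nonneg_block
    by (auto simp: T_def)
  also have "\<dots> \<le> (\<Sum>l\<in>T. sv (J l))"
  proof (rule sum_mono)
    fix l assume l: "l \<in> T"
    have "param I i \<le> sv (J l)" if "i \<in> F l" for i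
    proof -
      from that obtain x where x: "x < n" "lab x = l" "i = ord x" by (auto simp: F_def)
      then have "sv x \<le> sv (J x)" using traced_end(1)[OF t small] by blast
      then show ?thesis using x tr(4)[of x] by (simp add: sv_eq)
    qed
    then show "Max (param I ` F l) \<le> sv (J l)"
      using FT[OF l] by (subst Max_le_iff) auto
  qed
  also have "\<dots> = (\<Sum>x<n. if lab x = x then sv (J x) else 0)"
    unfolding T_def by (rule sum.inter_filter) simp
  also have "\<dots> = g 0" using traced_end(3)[OF t small] .
  finally show "cost I P \<le> g 0" .
qed

text \<open>If \<open>g 0 < big\<close>, the traced partition costs at most \<open>g 0\<close> and
  every feasible one at least \<open>g 0\<close>. Otherwise a feasible partition would cost at least
  \<open>big\<close>, against \<open>cost_less_big\<close>.\<close>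

lemma correct_outputI:
  assumes t: "traced n J B lab"
    and label: "\<And>x. x < n \<Longrightarrow> ints m ''label'' (int (ord x)) = int (lab x)"
    and feas: "ints m ''feasible'' 0 = (if g 0 < big then 1 else 0)"
    and cost: "reals m ''cost'' 0 = g 0"
  shows "correct_output I m"
proof (cases "g 0 < big")
  case True
  let ?P = "output_partition I m"
  have P: "feasible I ?P" "cost I ?P \<le> g 0"
    using traced_partition[OF t True, of "\<lambda>i. ints m ''label'' (int i)"] label
    unfolding output_partition_def by auto
  then have "cost I ?P = g 0" using lower_bound by force
  moreover have "optimal I ?P"
    unfolding optimal_def using P lower_bound by force
  ultimately show ?thesis using True feas cost P by (auto simp: correct_output_def)
next
  case False
  then have "\<not> (\<exists>P. feasible I P)"
    using lower_bound cost_less_big by force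
  then show ?thesis using False feas by (simp add: correct_output_def)
qed

end

section \<open>Filling the tables\<close>

lemma same_ints: "same c m m' \<Longrightarrow> x \<notin> imods c \<Longrightarrow> ints m' x = ints m x"
  and same_reals: "same c m m' \<Longrightarrow> x \<notin> rmods c \<Longrightarrow> reals m' x = reals m x"
  by (simp_all add: same_def)

text \<open>Replaces multiplication by lookups: \<open>off\<close> holds the multiples of the table
  size \<open>n * (W + 1)\<close> and \<open>ro\<close> those of the row length
  \<open>W + 1\<close>.\<close>

definition Cell :: "iexp \<Rightarrow> iexp \<Rightarrow> iexp \<Rightarrow> iexp" where
  "Cell s j w = IAdd (IAdd (IRead ''off'' s) (IRead ''ro'' j)) w"

definition fill :: "com \<Rightarrow> com" where
  "fill body = For ''j'' (IVar ''n'') (For ''v'' (IVar ''Q'') body)"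

definition init_cell :: com where
  "init_cell = Cond (BAnd (BNot (ILess (IVar ''v'') (IRead ''pw'' (IVar ''i''))))
      (BNot (RLess (RRead ''ps'' (IVar ''j'')) (RRead ''ps'' (IVar ''i'')))))
    (RWrite ''F'' (Cell (IVar ''i'') (IVar ''j'') (IVar ''v'')) (RConst 0))
    (RWrite ''F'' (Cell (IVar ''i'') (IVar ''j'') (IVar ''v'')) (RVar ''big''))"

definition init :: com where
  "init = For ''i'' (IVar ''n'') (Seq (IWrite ''cur'' (IVar ''i'') (IVar ''i'')) (fill init_cell))"

text \<open>The root is its own parent, so \<open>par\<close> maps positions to positions and the
  loops treat the root like any other node.\<close>

locale tables =
  fixes n W :: nat and par wt :: "nat \<Rightarrow> nat" and sv :: "nat \<Rightarrow> real" and big :: real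
  assumes n_pos: "0 < n"
    and par_0: "par 0 = 0"
    and par_less: "\<And>c. 0 < c \<Longrightarrow> c < n \<Longrightarrow> par c < c"
begin

definition adr :: "nat \<Rightarrow> nat \<Rightarrow> nat \<Rightarrow> nat" where
  "adr s j w = (s * n + j) * Suc W + w"

definition tab :: "memory \<Rightarrow> nat \<Rightarrow> nat \<Rightarrow> nat \<Rightarrow> real" where
  "tab m s j w = reals m ''F'' (int (adr s j w))"

definition ctab :: "memory \<Rightarrow> nat \<Rightarrow> nat \<Rightarrow> nat \<Rightarrow> int" where
  "ctab m s j w = ints m ''ch'' (int (adr s j w))"

definition ready :: "memory \<Rightarrow> bool" where
  "ready m \<longleftrightarrow> ints m ''n'' 0 = int n \<and> ints m ''Q'' 0 = int W + 1 \<and> reals m ''big'' 0 = big \<and>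
     (\<forall>x<n. ints m ''par'' (int x) = int (par x) \<and> ints m ''pw'' (int x) = int (wt x) \<and>
        reals m ''ps'' (int x) = sv x \<and> ints m ''ro'' (int x) = int (x * Suc W)) \<and>
     (\<forall>x<2*n. ints m ''off'' (int x) = int (x * (n * Suc W)))"

lemma adr_inject:
  assumes "j < n" "w \<le> W" "j' < n" "w' \<le> W"
  shows "adr s j w = adr s' j' w' \<longleftrightarrow> s = s' \<and> j = j' \<and> w = w'"
proof
  assume eq: "adr s j w = adr s' j' w'"
  have "adr s j w div Suc W = s * n + j" "adr s j w mod Suc W = w"
    "adr s' j' w' div Suc W = s' * n + j'" "adr s' j' w' mod Suc W = w'"
    using assms unfolding adr_def by (simp_all del: mult_Suc_right)
  then have 1: "w = w'" "s * n + j = s' * n + j'" using eq by simp_all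
  have "(s * n + j) div n = s" "(s * n + j) mod n = j"
    "(s' * n + j') div n = s'" "(s' * n + j') mod n = j'"
    using assms by simp_all
  with 1 show "s = s' \<and> j = j' \<and> w = w'" by simp
qed simp

lemma ready_same:
  assumes "ready m" "same c m m'"
    and "imods c \<inter> {''n'', ''Q'', ''par'', ''pw'', ''ro'', ''off''} = {}"
    and "rmods c \<inter> {''big'', ''ps''} = {}"
  shows "ready m'"
proof -
  have "ints m' x = ints m x" if "x \<in> {''n'', ''Q'', ''par'', ''pw'', ''ro'', ''off''}" for x
    using assms that by (intro same_ints) blast+
  moreover have "reals m' x = reals m x" if "x \<in> {''big'', ''ps''}" for x
    using assms that by (intro same_reals) blast+
  ultimately show ?thesis
    using assms(1) by (simp add: ready_def)
qed

lemma ival_Cell: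
  assumes "ready m" "ival s m = int s'" "s' < 2 * n" "ival j m = int j'" "j' < n"
    "ival w m = int w'"
  shows "ival (Cell s j w) m = int (adr s' j' w')"
  using assms by (simp add: ready_def Cell_def adr_def algebra_simps)

lemma tab_write_int [simp]: "tab (write_int x k a m) = tab m"
  by (simp add: tab_def fun_eq_iff)

lemma ctab_write_real [simp]: "ctab (write_real x k a m) = ctab m"
  by (simp add: ctab_def fun_eq_iff)

lemma ctab_write_int [simp]: "x \<noteq> ''ch'' \<Longrightarrow> ctab (write_int x k a m) = ctab m"
  by (simp add: ctab_def fun_eq_iff)

lemma tab_write_real [simp]: "x \<noteq> ''F'' \<Longrightarrow> tab (write_real x k a m) = tab m"
  by (simp add: tab_def fun_eq_iff)

definition touches :: "nat \<Rightarrow> nat \<Rightarrow> nat \<Rightarrow> memory \<Rightarrow> memory \<Rightarrow> bool" where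
  "touches s j w m m' \<longleftrightarrow> (\<forall>a. a \<noteq> int (adr s j w) \<longrightarrow>
     reals m' ''F'' a = reals m ''F'' a \<and> ints m' ''ch'' a = ints m ''ch'' a)"

lemma touches_tab:
  assumes "touches s j w m m'" "j < n" "w \<le> W" "j' < n" "w' \<le> W" "(s', j', w') \<noteq> (s, j, w)"
  shows "tab m' s' j' w' = tab m s' j' w'" "ctab m' s' j' w' = ctab m s' j' w'"
  using assms adr_inject[OF assms(4,5,2,3), of s' s] unfolding touches_def tab_def ctab_def by auto

definition others :: "nat \<Rightarrow> memory \<Rightarrow> memory \<Rightarrow> bool" where
  "others s m m' \<longleftrightarrow> (\<forall>s' j w. s' \<noteq> s \<longrightarrow> j < n \<longrightarrow> w \<le> W \<longrightarrow>
     tab m' s' j w = tab m s' j w \<and> ctab m' s' j w = ctab m s' j w)"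

text \<open>The body may rely on all other regions being as they were at the start
  (\<open>others\<close>) and must confine itself to its own cell (\<open>touches\<close>), so cells
  filled earlier keep satisfying \<open>R\<close>.\<close>

lemma runs_fill:
  assumes rdy: "ready m"
    and mods: "imods body \<inter> {''n'', ''Q'', ''j'', ''v''} = {}"
    and body: "\<And>j w m'. j < n \<Longrightarrow> w \<le> W \<Longrightarrow> ints m' ''j'' 0 = int j \<Longrightarrow>
      ints m' ''v'' 0 = int w \<Longrightarrow> same (fill body) m m' \<Longrightarrow> others s m m' \<Longrightarrow>
      runs body m' T (\<lambda>m''. R j w (tab m'' s j w) (ctab m'' s j w) \<and> touches s j w m' m'')"
    and time: "n * (Suc W * (T + 12) + 21) + 9 \<le> U"
  shows "runs (fill body) m U (\<lambda>m'.
    (\<forall>j<n. \<forall>w\<le>W. R j w (tab m' s j w) (ctab m' s j w)) \<and> others s m m' \<and>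
    same (fill body) m m')"
proof -
  let ?R = "\<lambda>m' j w. R j w (tab m' s j w) (ctab m' s j w)"
  let ?I = "\<lambda>l m'. (\<forall>j<l. \<forall>w\<le>W. ?R m' j w) \<and> others s m m'"
  have nQ: "ints m ''n'' 0 = int n" "ints m ''Q'' 0 = int (Suc W)"
    using rdy by (simp_all add: ready_def)
  have row: "runs (For ''v'' (IVar ''Q'') body) m' (Suc W * (T + 12) + 9) (?I (Suc l))"
    if l: "l < n" "ints m' ''j'' 0 = int l" and I: "?I l m'" and s: "same (fill body) m m'"
    for l m'
  proof -
    let ?I' = "\<lambda>u m''. ?I l m'' \<and> (\<forall>w<u. ?R m'' l w)"
    have "runs (For ''v'' (IVar ''Q'') body) m' (Suc W * (T + 12) + 9)
      (\<lambda>m''. ?I' (Suc W) m'' \<and> same (For ''v'' (IVar ''Q'') body) m' m'')"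
    proof (rule runs_For[where Inv = ?I' and T = T])
      show "?I' 0 m'" using I by simp
      show "''v'' \<notin> imods body" using mods by blast
      show "ival (IVar ''Q'') m'' = int (Suc W)" if "same (For ''v'' (IVar ''Q'') body) m' m''" for m''
        using same_ints[OF s, of "''Q''"] same_ints[OF that, of "''Q''"] mods nQ
        by (simp add: fill_def)
      show "?I' k (write_int ''v'' 0 a m'')" if "?I' k m''" for k m'' a
        using that by (simp add: others_def)
      fix u m'' assume u: "u < Suc W" "ints m'' ''v'' 0 = int u" and I': "?I' u m''"
        and s': "same (For ''v'' (IVar ''Q'') body) m' m''"
      have s2: "same (fill body) m m''"
        using s s' by (simp add: same_def fill_def)
      have "ints m'' ''j'' 0 = int l"
        using l same_ints[OF s', of "''j''"] mods by simp
      from body[OF l(1) _ this u(2) s2] u I'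
      have "runs body m'' T (\<lambda>m3. ?R m3 l u \<and> touches s l u m'' m3)" by simp
      then show "runs body m'' T (?I' (Suc u))"
      proof (rule runs_mono)
        fix m3 assume m3: "?R m3 l u \<and> touches s l u m'' m3"
        have eq: "tab m3 s' j w = tab m'' s' j w" "ctab m3 s' j w = ctab m'' s' j w"
          if "j < n" "w \<le> W" "s' \<noteq> s \<or> j \<noteq> l \<or> w \<noteq> u" for s' j w
          using touches_tab[of s l u m'' m3 j w s'] m3 l u that by auto
        have "others s m m3"
          using I' eq unfolding others_def by auto
        moreover have "?R m3 j w" if "j < l" "w \<le> W" for j w
          using I' eq[of j w s] that l by auto
        moreover have "?R m3 l w" if "w < Suc u" for w
          using I' eq[of l w s] m3 that l u by (cases "w = u") auto
        ultimately show "?I' (Suc u) m3" by blast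
      qed simp
    qed simp
    then show ?thesis
    proof (rule runs_mono)
      fix m'' assume m'': "?I' (Suc W) m'' \<and> same (For ''v'' (IVar ''Q'') body) m' m''"
      have "?R m'' j w" if "j < Suc l" "w \<le> W" for j w
        using m'' that by (cases "j = l") simp_all
      then show "?I (Suc l) m''" using m'' by blast
    qed simp
  qed
  have "runs (fill body) m U (\<lambda>m'. ?I n m' \<and> same (fill body) m m')"
    unfolding fill_def
  proof (rule runs_For[where Inv = ?I and T = "Suc W * (T + 12) + 9"])
    show "?I 0 m" by (simp add: others_def)
    show "''j'' \<notin> imods (For ''v'' (IVar ''Q'') body)" using mods by simp
    show "ival (IVar ''n'') m' = int n"
      if "same (For ''j'' (IVar ''n'') (For ''v'' (IVar ''Q'') body)) m m'" for m'
      using same_ints[OF that, of "''n''"] mods nQ by simp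
    show "?I k (write_int ''j'' 0 a m')" if "?I k m'" for k m' a
      using that by (simp add: others_def)
    show "runs (For ''v'' (IVar ''Q'') body) m' (Suc W * (T + 12) + 9) (?I (Suc k))"
      if "k < n" "ints m' ''j'' 0 = int k" "?I k m'"
        "same (For ''j'' (IVar ''n'') (For ''v'' (IVar ''Q'') body)) m m'" for k m'
      using row that by (simp add: fill_def)
    show "n * (Suc W * (T + 12) + 9 + itime (IVar ''n'') + 10) + itime (IVar ''n'') + 7 \<le> U"
      using time by simp
  qed
  then show ?thesis
    by (rule runs_mono) auto
qed

definition base :: "nat \<Rightarrow> nat \<Rightarrow> nat \<Rightarrow> real" where
  "base x j w = (if wt x \<le> w \<and> sv x \<le> sv j then 0 else big)"

definition initial :: "nat \<Rightarrow> memory \<Rightarrow> bool" where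
  "initial k m \<longleftrightarrow> (\<forall>x<k. ints m ''cur'' (int x) = int x \<and>
     (\<forall>j<n. \<forall>w\<le>W. tab m x j w = base x j w))"

lemma runs_init:
  assumes rdy: "ready m" and time: "n * (n * (Suc W * 72 + 21) + 26) + 9 \<le> U"
  shows "runs init m U (\<lambda>m'. initial n m' \<and> same init m m')"
  unfolding init_def
proof (rule runs_For[where Inv = initial and T = "5 + (n * (Suc W * 72 + 21) + 9)"])
  let ?body = "Seq (IWrite ''cur'' (IVar ''i'') (IVar ''i'')) (fill init_cell)"
  let ?c = "For ''i'' (IVar ''n'') ?body"
  have rdy': "ready m'" if "same ?c m m'" for m'
    using rdy that by (rule ready_same) (auto simp: fill_def init_cell_def)
  show "initial 0 m" by (simp add: initial_def)
  show "''i'' \<notin> imods ?body" by (simp add: fill_def init_cell_def)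
  show "ival (IVar ''n'') m' = int n" if "same ?c m m'" for m'
    using rdy'[OF that] by (simp add: ready_def)
  show "initial k (write_int ''i'' 0 a m')" if "initial k m'" for k m' a
    using that by (simp add: initial_def)
  fix i m' assume i: "i < n" "ints m' ''i'' 0 = int i" and I: "initial i m'" and s: "same ?c m m'"
  let ?m = "write_int ''cur'' (int i) (int i) m'"
  have rdy2: "ready ?m" using rdy'[OF s] by (simp add: ready_def)
  show "runs ?body m' (5 + (n * (Suc W * 72 + 21) + 9)) (initial (Suc i))"
  proof (rule runs_Seq)
    show "runs (IWrite ''cur'' (IVar ''i'') (IVar ''i'')) m' 5 (\<lambda>m2. m2 = ?m)"
      using i by (intro runs_flat) simp_all
    fix m2 assume m2: "m2 = ?m"
    have "runs (fill init_cell) ?m (n * (Suc W * 72 + 21) + 9) (\<lambda>m3.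
      (\<forall>j<n. \<forall>w\<le>W. tab m3 i j w = base i j w) \<and> others i ?m m3 \<and> same (fill init_cell) ?m m3)"
    proof (rule runs_fill[OF rdy2, where R = "\<lambda>j w v c. v = base i j w" and T = 60])
      show "imods init_cell \<inter> {''n'', ''Q'', ''j'', ''v''} = {}"
        by (simp add: init_cell_def)
      fix j w m3 assume j: "j < n" "w \<le> W" "ints m3 ''j'' 0 = int j" "ints m3 ''v'' 0 = int w"
        and s3: "same (fill init_cell) ?m m3"
      have r3: "ready m3"
        using rdy2 s3 by (rule ready_same) (auto simp: fill_def init_cell_def)
      have i3: "ints m3 ''i'' 0 = int i"
        using same_ints[OF s3, of "''i''"] i by (simp add: fill_def init_cell_def)
      have a: "ival (Cell (IVar ''i'') (IVar ''j'') (IVar ''v'')) m3 = int (adr i j w)"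
        using r3 i i3 j by (intro ival_Cell) auto
      have v: "ints m3 ''pw'' (int i) = int (wt i)" "reals m3 ''ps'' (int i) = sv i"
        "reals m3 ''ps'' (int j) = sv j" "reals m3 ''big'' 0 = big"
        using r3 i j by (auto simp: ready_def)
      show "runs init_cell m3 60 (\<lambda>m4. tab m4 i j w = base i j w \<and> touches i j w m3 m4)"
        unfolding init_cell_def
        by (rule runs_flat)
          (use a v i3 j in \<open>auto simp: base_def touches_def tab_def Cell_def\<close>)
    qed simp
    then show "runs (fill init_cell) m2 (n * (Suc W * 72 + 21) + 9) (initial (Suc i))"
      unfolding m2
    proof (rule runs_mono)
      fix m3 assume m3: "(\<forall>j<n. \<forall>w\<le>W. tab m3 i j w = base i j w) \<and> others i ?m m3 \<and>
        same (fill init_cell) ?m m3"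
      have "ints m3 ''cur'' = ints ?m ''cur''"
        using m3 by (intro same_ints[of "fill init_cell"]) (auto simp: fill_def init_cell_def)
      moreover have "tab m3 x j w = tab m' x j w" if "x \<noteq> i" "j < n" "w \<le> W" for x j w
        using m3 that by (simp add: others_def)
      ultimately show "initial (Suc i) m3"
        using I m3 by (auto simp: initial_def less_Suc_eq)
    qed simp
  qed
qed (use time in \<open>simp add: algebra_simps\<close>)

end

section \<open>Merging a child into its parent\<close>

definition merge_cell :: com where
  "merge_cell =
     Seq (Seq (RWrite ''F'' (Cell (IVar ''sn'') (IVar ''j'') (IVar ''v''))
         (RAdd (RRead ''F'' (Cell (IVar ''sp'') (IVar ''j'') (IVar ''v''))) (RRead ''g'' (IVar ''c''))))
       (IWrite ''ch'' (Cell (IVar ''sn'') (IVar ''j'') (IVar ''v'')) (IConst (- 1))))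
     (For ''u'' (IAdd (IVar ''v'') (IConst 1))
       (Cond (RLess (RAdd (RRead ''F'' (Cell (IVar ''sp'') (IVar ''j'') (ISub (IVar ''v'') (IVar ''u''))))
             (RRead ''F'' (Cell (IVar ''sc'') (IVar ''j'') (IVar ''u''))))
           (RRead ''F'' (Cell (IVar ''sn'') (IVar ''j'') (IVar ''v''))))
         (Seq (RWrite ''F'' (Cell (IVar ''sn'') (IVar ''j'') (IVar ''v''))
             (RAdd (RRead ''F'' (Cell (IVar ''sp'') (IVar ''j'') (ISub (IVar ''v'') (IVar ''u''))))
               (RRead ''F'' (Cell (IVar ''sc'') (IVar ''j'') (IVar ''u'')))))
           (IWrite ''ch'' (Cell (IVar ''sn'') (IVar ''j'') (IVar ''v'')) (IVar ''u'')))
         Skip))"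

text \<open>The search for the minimum starts at index 0 rather than at an infinite value, so
  \<open>bj\<close> always names an index that attains it.\<close>

definition select :: com where
  "select =
     Seq (RWrite ''g'' (IVar ''c'') (RAdd (RRead ''ps'' (IConst 0))
       (RRead ''F'' (Cell (IVar ''sc'') (IConst 0) (ISub (IVar ''Q'') (IConst 1))))))
     (Seq (IWrite ''bj'' (IVar ''c'') (IConst 0))
     (For ''j'' (IVar ''n'')
       (Cond (RLess (RAdd (RRead ''ps'' (IVar ''j''))
             (RRead ''F'' (Cell (IVar ''sc'') (IVar ''j'') (ISub (IVar ''Q'') (IConst 1)))))
           (RRead ''g'' (IVar ''c'')))
         (Seq (RWrite ''g'' (IVar ''c'') (RAdd (RRead ''ps'' (IVar ''j''))
             (RRead ''F'' (Cell (IVar ''sc'') (IVar ''j'') (ISub (IVar ''Q'') (IConst 1))))))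
           (IWrite ''bj'' (IVar ''c'') (IVar ''j'')))
         Skip)))"

definition merge_setup :: com where
  "merge_setup =
     Seq (ISet ''c'' (ISub (ISub (IVar ''n'') (IConst 1)) (IVar ''i'')))
     (Seq (ISet ''sc'' (IRead ''cur'' (IVar ''c'')))
     (Seq (ISet ''sp'' (IRead ''cur'' (IRead ''par'' (IVar ''c''))))
     (ISet ''sn'' (IAdd (IVar ''n'') (IVar ''c'')))))"

definition merge_step :: com where
  "merge_step = Seq merge_setup (Seq select (Seq (fill merge_cell)
     (IWrite ''cur'' (IRead ''par'' (IVar ''c'')) (IVar ''sn''))))"

text \<open>The children are \<open>n - 1\<close> down to 0. The round for 0 computes
  \<open>g 0\<close>, the optimum; since the root is its own parent, it runs like all
  others.\<close>

definition merge :: com where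
  "merge = For ''i'' (IVar ''n'') merge_step"

text \<open>
  The cell for budget \<open>w\<close> after the options to cut and to give a budget \<open>u < k\<close> to the child
  have been considered; \<open>a\<close> and \<open>b\<close> are the rows of the parent and of the child.
\<close>

definition merged ::
    "nat \<Rightarrow> (nat \<Rightarrow> real) \<Rightarrow> (nat \<Rightarrow> real) \<Rightarrow> real \<Rightarrow> nat \<Rightarrow> real \<Rightarrow> int \<Rightarrow> bool" where
  "merged k a b r w v c \<longleftrightarrow> v \<le> a w + r \<and> (\<forall>u<k. v \<le> a (w - u) + b u) \<and>
     (c = - 1 \<and> v = a w + r \<or> (\<exists>u\<le>w. c = int u \<and> v = a (w - u) + b u))"

text \<open>Only budgets up to \<open>w\<close> are read, so agreement of the rows inside their
  bounds suffices; cells past \<open>W\<close> belong to other rows.\<close>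

lemma merged_cong:
  assumes "\<And>u. u \<le> w \<Longrightarrow> a' u = a u" "\<And>u. u \<le> w \<Longrightarrow> b' u = b u"
  shows "merged (Suc w) a' b' r w v c \<longleftrightarrow> merged (Suc w) a b r w v c"
proof -
  have "(\<forall>u<Suc w. v \<le> a' (w - u) + b' u) \<longleftrightarrow> (\<forall>u<Suc w. v \<le> a (w - u) + b u)"
    "(\<exists>u\<le>w. c = int u \<and> v = a' (w - u) + b' u) \<longleftrightarrow> (\<exists>u\<le>w. c = int u \<and> v = a (w - u) + b u)"
    using assms by auto
  then show ?thesis using assms(1)[of w] by (simp add: merged_def)
qed

context tables
begin

lemma runs_merge_cell:
  assumes rdy: "ready m"
    and sn: "ints m ''sn'' 0 = int sn" "sn < 2 * n"
    and sp: "ints m ''sp'' 0 = int sp" "sp < 2 * n" "sp \<noteq> sn"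
    and sc: "ints m ''sc'' 0 = int sc" "sc < 2 * n" "sc \<noteq> sn"
    and j: "ints m ''j'' 0 = int j" "j < n"
    and w: "ints m ''v'' 0 = int w" "w \<le> W"
    and c: "ints m ''c'' 0 = int c"
  shows "runs merge_cell m (Suc W * 120 + 60) (\<lambda>m'.
    merged (Suc w) (tab m sp j) (tab m sc j) (reals m ''g'' (int c)) w
      (tab m' sn j w) (ctab m' sn j w) \<and> touches sn j w m m')"
proof -
  define a b r where "a = tab m sp j" and "b = tab m sc j" and "r = reals m ''g'' (int c)"
  let ?I = "\<lambda>k m'. merged k a b r w (tab m' sn j w) (ctab m' sn j w) \<and> touches sn j w m m'"
  let ?start = "Seq (RWrite ''F'' (Cell (IVar ''sn'') (IVar ''j'') (IVar ''v''))
       (RAdd (RRead ''F'' (Cell (IVar ''sp'') (IVar ''j'') (IVar ''v''))) (RRead ''g'' (IVar ''c''))))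
     (IWrite ''ch'' (Cell (IVar ''sn'') (IVar ''j'') (IVar ''v'')) (IConst (- 1)))"
  let ?m = "write_int ''ch'' (int (adr sn j w)) (- 1)
    (write_real ''F'' (int (adr sn j w)) (a w + r) m)"
  have adr_ne: "adr sp j w' \<noteq> adr sn j w" "adr sc j w' \<noteq> adr sn j w" if "w' \<le> W" for w'
    using adr_inject[of j w' j w] that j w sp sc by auto
  have cells: "ival (Cell (IVar ''sn'') (IVar ''j'') (IVar ''v'')) m' = int (adr sn j w)"
    "ival (Cell (IVar ''sp'') (IVar ''j'') e) m' = int (adr sp j w')"
    "ival (Cell (IVar ''sc'') (IVar ''j'') e) m' = int (adr sc j w')"
    if "ready m'" "ints m' ''sn'' = ints m ''sn''" "ints m' ''sp'' = ints m ''sp''"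
      "ints m' ''sc'' = ints m ''sc''" "ints m' ''j'' = ints m ''j''" "ints m' ''v'' = ints m ''v''"
      "ival e m' = int w'" for m' e w'
    using that sn sp sc j w by (auto intro!: ival_Cell)
  have "runs ?start m 40 (\<lambda>m'. m' = ?m)"
  proof (rule runs_flat)
    have rdy': "ready (write_real ''F'' x y m)" for x y
      using rdy by (simp add: ready_def)
    show "run ?start m = ?m"
      using cells[OF rdy _ _ _ _ _ , of "IVar ''v''" w] cells(1)[OF rdy', of _ _ "IVar ''v''" w] w c
      by (simp add: a_def r_def tab_def)
  qed (simp_all add: Cell_def)
  moreover
  let ?body = "Cond (RLess (RAdd (RRead ''F'' (Cell (IVar ''sp'') (IVar ''j'') (ISub (IVar ''v'') (IVar ''u''))))
             (RRead ''F'' (Cell (IVar ''sc'') (IVar ''j'') (IVar ''u''))))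
           (RRead ''F'' (Cell (IVar ''sn'') (IVar ''j'') (IVar ''v''))))
         (Seq (RWrite ''F'' (Cell (IVar ''sn'') (IVar ''j'') (IVar ''v''))
             (RAdd (RRead ''F'' (Cell (IVar ''sp'') (IVar ''j'') (ISub (IVar ''v'') (IVar ''u''))))
               (RRead ''F'' (Cell (IVar ''sc'') (IVar ''j'') (IVar ''u'')))))
           (IWrite ''ch'' (Cell (IVar ''sn'') (IVar ''j'') (IVar ''v'')) (IVar ''u'')))
         Skip"
  let ?loop = "For ''u'' (IAdd (IVar ''v'') (IConst 1)) ?body"
  have "runs ?loop ?m (Suc W * 116 + 11) (\<lambda>m'. ?I (Suc w) m' \<and> same ?loop ?m m')"
  proof (rule runs_For[where Inv = ?I and T = 100])
    show "?I 0 ?m"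
      by (simp add: merged_def touches_def tab_def ctab_def)
    show "ival (IAdd (IVar ''v'') (IConst 1)) m' = int (Suc w)" if "same ?loop ?m m'" for m'
      using same_ints[OF that, of "''v''"] w by simp
    show "?I k (write_int ''u'' 0 x m')" if "?I k m'" for k m' x
      using that by (simp add: touches_def)
    show "Suc w * (100 + itime (IAdd (IVar ''v'') (IConst 1)) + 10) +
      itime (IAdd (IVar ''v'') (IConst 1)) + 7 \<le> Suc W * 116 + 11"
      using w by simp
    fix u m' assume u: "u < Suc w" "ints m' ''u'' 0 = int u" and I: "?I u m'"
      and s: "same ?loop ?m m'"
    have s': "ints m' x = ints ?m x" if "x \<notin> {''u'', ''ch''}" for x
      using same_ints[OF s, of x] that by simp
    have rdy': "ready m'"
    proof -
      have "ready ?m" using rdy by (simp add: ready_def)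
      then show ?thesis using s by (rule ready_same) auto
    qed
    then have rdy2: "ready (write_real ''F'' x y m')" for x y
      by (simp add: ready_def)
    let ?x = "tab m' sp j (w - u) + tab m' sc j u"
    have x: "?x = a (w - u) + b u"
      using I adr_ne[of "w - u"] adr_ne[of u] u w
      by (simp add: touches_def tab_def a_def b_def)
    let ?m' = "write_int ''ch'' (int (adr sn j w)) (int u)
      (write_real ''F'' (int (adr sn j w)) ?x m')"
    have wu: "ival (ISub (IVar ''v'') (IVar ''u'')) m' = int (w - u)" "ival (IVar ''u'') m' = int u"
      using u w s'[of "''v''"] by auto
    have "run ?body m' = (if ?x < tab m' sn j w then ?m' else m')"
      using cells(1)[OF rdy', of "IVar ''u''" u] cells(2)[OF rdy', of _ "w - u"]
        cells(3)[OF rdy', of "IVar ''u''" u] cells(1)[OF rdy2, of _ _ "IVar ''u''" u] wu u s'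
      by (simp add: tab_def)
    moreover have "?I (Suc u) (if ?x < tab m' sn j w then ?m' else m')"
    proof (cases "?x < tab m' sn j w")
      case True
      have new: "tab ?m' sn j w = ?x" "ctab ?m' sn j w = int u" "touches sn j w m ?m'"
        using I by (simp_all add: tab_def ctab_def touches_def)
      then show ?thesis
        using True I u x by (auto simp: merged_def less_Suc_eq simp del: tab_write_int)
    next
      case False
      then show ?thesis using I x by (auto simp: merged_def less_Suc_eq)
    qed
    ultimately show "runs ?body m' 100 (?I (Suc u))"
      by (intro runs_flat) (simp_all add: Cell_def)
  qed simp
  ultimately have "runs (Seq ?start ?loop) m (40 + (Suc W * 116 + 11)) (?I (Suc w))"
    by (intro runs_Seq) (auto elim: runs_mono)
  then show ?thesis unfolding a_def b_def r_def merge_cell_def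
    by (rule runs_mono) auto
qed

end

context tables
begin

definition chosen :: "nat \<Rightarrow> (nat \<Rightarrow> real) \<Rightarrow> nat \<Rightarrow> memory \<Rightarrow> bool" where
  "chosen k h c m \<longleftrightarrow> (\<exists>b<n. ints m ''bj'' (int c) = int b \<and> reals m ''g'' (int c) = sv b + h b) \<and>
     (\<forall>j<k. reals m ''g'' (int c) \<le> sv j + h j)"

definition keeps :: "nat \<Rightarrow> memory \<Rightarrow> memory \<Rightarrow> bool" where
  "keeps c m m' \<longleftrightarrow> (\<forall>x. x \<noteq> int c \<longrightarrow> ints m' ''bj'' x = ints m ''bj'' x \<and>
     reals m' ''g'' x = reals m ''g'' x)"

lemma runs_select:
  assumes rdy: "ready m"
    and sc: "ints m ''sc'' 0 = int sc" "sc < 2 * n"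
    and c: "ints m ''c'' 0 = int c"
  shows "runs select m (n * 112 + 50) (\<lambda>m'. chosen n (\<lambda>j. tab m sc j W) c m' \<and>
    keeps c m m' \<and> same select m m')"
proof (rule runs_mono[OF runs_same])
  define h where "h = (\<lambda>j. tab m sc j W)"
  let ?I = "\<lambda>k m'. chosen k h c m' \<and> keeps c m m'"
  let ?w = "ISub (IVar ''Q'') (IConst 1)"
  let ?a = "RWrite ''g'' (IVar ''c'') (RAdd (RRead ''ps'' (IConst 0))
       (RRead ''F'' (Cell (IVar ''sc'') (IConst 0) ?w)))"
  let ?b = "IWrite ''bj'' (IVar ''c'') (IConst 0)"
  let ?body = "Cond (RLess (RAdd (RRead ''ps'' (IVar ''j'')) (RRead ''F'' (Cell (IVar ''sc'') (IVar ''j'') ?w)))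
           (RRead ''g'' (IVar ''c'')))
         (Seq (RWrite ''g'' (IVar ''c'') (RAdd (RRead ''ps'' (IVar ''j''))
             (RRead ''F'' (Cell (IVar ''sc'') (IVar ''j'') ?w))))
           (IWrite ''bj'' (IVar ''c'') (IVar ''j'')))
         Skip"
  let ?loop = "For ''j'' (IVar ''n'') ?body"
  let ?m1 = "write_real ''g'' (int c) (sv 0 + h 0) m"
  let ?m = "write_int ''bj'' (int c) 0 ?m1"
  have w: "ival ?w m' = int W" if "ready m'" for m'
    using that by (simp add: ready_def)
  have "ival (Cell (IVar ''sc'') (IConst 0) ?w) m = int (adr sc 0 W)"
    using rdy sc n_pos by (intro ival_Cell w) auto
  then have "runs ?a m 30 (\<lambda>m'. m' = ?m1)"
    using rdy n_pos c by (intro runs_flat) (auto simp: ready_def h_def tab_def Cell_def)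
  moreover have "runs (Seq ?b ?loop) ?m1 (4 + (n * 112 + 9)) (?I n)"
  proof (rule runs_Seq)
    show "runs ?b ?m1 4 (\<lambda>m'. m' = ?m)"
      using c by (intro runs_flat) auto
    fix m2 assume m2: "m2 = ?m"
    have "runs ?loop ?m (n * 112 + 9) (\<lambda>m'. ?I n m' \<and> same ?loop ?m m')"
    proof (rule runs_For[where Inv = ?I and T = 100])
      show "?I 0 ?m"
        using n_pos by (auto simp: chosen_def keeps_def)
      show "ival (IVar ''n'') m' = int n" if "same ?loop ?m m'" for m'
        using same_ints[OF that, of "''n''"] rdy by (simp add: ready_def)
      show "?I k (write_int ''j'' 0 x m')" if "?I k m'" for k m' x
        using that by (simp add: chosen_def keeps_def)
      fix j m' assume j: "j < n" "ints m' ''j'' 0 = int j" and I: "?I j m'"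
        and s: "same ?loop ?m m'"
      have rdy': "ready m'"
      proof -
        have "ready ?m" using rdy by (simp add: ready_def)
        then show ?thesis using s by (rule ready_same) auto
      qed
      have c': "ints m' ''c'' 0 = int c" "ints m' ''sc'' 0 = int sc"
        using same_ints[OF s, of "''c''"] same_ints[OF s, of "''sc''"] c sc by auto
      have sv: "reals m' ''ps'' (int j) = sv j" using rdy' j by (simp add: ready_def)
      have a: "ival (Cell (IVar ''sc'') (IVar ''j'') ?w) m' = int (adr sc j W)"
        using rdy' sc c' j by (intro ival_Cell w) auto
      have h: "reals m' ''F'' (int (adr sc j W)) = h j"
        using same_reals[OF s, of "''F''"] by (simp add: h_def tab_def)
      let ?m' = "write_int ''bj'' (int c) (int j) (write_real ''g'' (int c) (sv j + h j) m')"
      have "run ?body m' = (if sv j + h j < reals m' ''g'' (int c) then ?m' else m')"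
        using a c' sv h j by simp
      moreover have "?I (Suc j) (if sv j + h j < reals m' ''g'' (int c) then ?m' else m')"
      proof (cases "sv j + h j < reals m' ''g'' (int c)")
        case True
        have "\<forall>k<j. sv j + h j \<le> sv k + h k"
          using I True by (force simp: chosen_def)
        then have "chosen (Suc j) h c ?m'"
          unfolding chosen_def using j by (auto simp: less_Suc_eq)
        moreover have "keeps c m ?m'" using I by (simp add: keeps_def)
        ultimately show ?thesis using True by simp
      next
        case False
        then show ?thesis using I by (auto simp: chosen_def less_Suc_eq)
      qed
      ultimately show "runs ?body m' 100 (?I (Suc j))"
        by (intro runs_flat) (simp_all add: Cell_def)
    qed simp_all
    then show "runs ?loop m2 (n * 112 + 9) (?I n)"
      unfolding m2 by (rule runs_mono) auto
  qed
  ultimately have "runs (Seq ?a (Seq ?b ?loop)) m (30 + (4 + (n * 112 + 9))) (?I n)"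
    by - (erule runs_Seq, simp)
  then show "runs select m (30 + (4 + (n * 112 + 9)))
    (\<lambda>m'. chosen n (\<lambda>j. tab m sc j W) c m' \<and> keeps c m m')"
    unfolding select_def h_def .
qed auto

text \<open>The table of a node lives in a fresh slot \<open>n + c\<close> after the child \<open>c\<close> has been merged into it.\<close>

primrec slot :: "nat \<Rightarrow> nat \<Rightarrow> nat" where
  "slot 0 = (\<lambda>x. x)"
| "slot (Suc i) = (slot i)(par (n - Suc i) := n + (n - Suc i))"

text \<open>The slots in use after \<open>i\<close> merges are initial or lie above
  \<open>n + (n - Suc i)\<close>, the one written next. So that slot is fresh, and the tables of
  parent and child can be read while it is filled.\<close>

lemma slot_bounds:
  assumes "i \<le> n" "x < n"
  shows "slot i x < 2 * n" "slot i x < n \<or> n + (n - i) \<le> slot i x"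
  using assms by (induction i arbitrary: x) (auto, fastforce)

text \<open>The memory may be one reached after many further merges. As no slot is overwritten, all
  recurrences can finally be collected from a single memory.\<close>

definition step :: "nat \<Rightarrow> memory \<Rightarrow> bool" where
  "step i m \<longleftrightarrow> (let c = n - Suc i in chosen n (\<lambda>j. tab m (slot i c) j W) c m \<and>
     (\<forall>j<n. \<forall>w\<le>W. merged (Suc w) (tab m (slot i (par c)) j) (tab m (slot i c) j)
        (reals m ''g'' (int c)) w (tab m (n + c) j w) (ctab m (n + c) j w)))"

lemma par_lt: "c < n \<Longrightarrow> par c < n"
  using par_less[of c] par_0 by (cases "c = 0") auto

text \<open>Step \<open>i\<close> involves only initial slots and slots from
  \<open>n + (n - Suc i)\<close> on; later merges write strictly between these two ranges.\<close>

lemma step_cong: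
  assumes "step i m" and i: "i < n"
    and slots: "\<And>s j w. s < n \<or> n + (n - Suc i) \<le> s \<Longrightarrow> j < n \<Longrightarrow> w \<le> W \<Longrightarrow>
      tab m' s j w = tab m s j w \<and> ctab m' s j w = ctab m s j w"
    and "reals m' ''g'' (int (n - Suc i)) = reals m ''g'' (int (n - Suc i))"
    and "ints m' ''bj'' (int (n - Suc i)) = ints m ''bj'' (int (n - Suc i))"
  shows "step i m'"
proof -
  let ?c = "n - Suc i"
  have c: "?c < n" "par ?c < n" using i par_lt[of ?c] by auto
  have eq: "tab m' (slot i x) j w = tab m (slot i x) j w" if "x < n" "j < n" "w \<le> W" for x j w
    using slot_bounds(2)[of i x] i that by (intro conjunct1[OF slots]) auto
  have new: "tab m' (n + ?c) j w = tab m (n + ?c) j w"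
    "ctab m' (n + ?c) j w = ctab m (n + ?c) j w" if "j < n" "w \<le> W" for j w
    using slots that by auto
  have "merged (Suc w) (tab m' (slot i (par ?c)) j) (tab m' (slot i ?c) j) r w v d \<longleftrightarrow>
    merged (Suc w) (tab m (slot i (par ?c)) j) (tab m (slot i ?c) j) r w v d"
    if "j < n" "w \<le> W" for j w r v d
    using c eq that by (intro merged_cong) auto
  then show ?thesis
    using assms(1,4,5) new eq[OF c(1)] unfolding step_def Let_def chosen_def by auto
qed

definition merging :: "nat \<Rightarrow> memory \<Rightarrow> bool" where
  "merging k m \<longleftrightarrow> (\<forall>x<n. ints m ''cur'' (int x) = int (slot k x)) \<and>
     (\<forall>x<n. \<forall>j<n. \<forall>w\<le>W. tab m x j w = base x j w) \<and> (\<forall>i<k. step i m)"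

abbreviation "merge_step_time \<equiv> n * (Suc W * (Suc W * 120 + 72) + 150) + 200"

lemma runs_merge_step:
  assumes rdy: "ready m" and k: "k < n" "ints m ''i'' 0 = int k" and I: "merging k m"
  shows "runs merge_step m merge_step_time (merging (Suc k))"
proof -
  define c where "c = n - Suc k"
  have c: "c < n" "par c < n" using k par_lt[of c] by (auto simp: c_def)
  let ?sc = "slot k c" and ?sp = "slot k (par c)" and ?sn = "n + c"
  have sc: "?sc < 2 * n" "?sc \<noteq> ?sn" and sp: "?sp < 2 * n" "?sp \<noteq> ?sn" and sn: "?sn < 2 * n"
    using slot_bounds[of k c] slot_bounds[of k "par c"] k c by (auto simp: c_def)
  let ?m1 = "write_int ''sn'' 0 (int ?sn) (write_int ''sp'' 0 (int ?sp)
    (write_int ''sc'' 0 (int ?sc) (write_int ''c'' 0 (int c) m)))"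
  have n1: "int n - 1 - int k = int c"
    using k by (simp add: c_def)
  have "runs merge_setup m 40 (\<lambda>m'. m' = ?m1)"
    using rdy I k c n1 unfolding merge_setup_def
    by (intro runs_flat) (auto simp: ready_def merging_def)
  moreover have "runs (Seq select (Seq (fill merge_cell) (IWrite ''cur'' (IRead ''par'' (IVar ''c'')) (IVar ''sn''))))
    ?m1 ((n * 112 + 50) + ((n * (Suc W * ((Suc W * 120 + 60) + 12) + 21) + 9) + 6)) (merging (Suc k))"
  proof (rule runs_Seq)
    have r1: "ready ?m1" using rdy by (simp add: ready_def)
    show "runs select ?m1 (n * 112 + 50) (\<lambda>m'. chosen n (\<lambda>j. tab ?m1 ?sc j W) c m' \<and>
      keeps c ?m1 m' \<and> same select ?m1 m')"
      by (rule runs_select[OF r1]) (use sc in simp_all)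
    fix m2 assume m2: "chosen n (\<lambda>j. tab ?m1 ?sc j W) c m2 \<and> keeps c ?m1 m2 \<and> same select ?m1 m2"
    then have s2: "same select ?m1 m2" by blast
    have r2: "ready m2"
      using r1 s2 by (rule ready_same) (simp_all add: select_def)
    have int2: "ints m2 x = ints ?m1 x" if "x \<notin> {''bj'', ''j''}" for x
      using that by (intro same_ints[OF s2]) (auto simp: select_def)
    have real2: "reals m2 ''F'' = reals m ''F''"
      using same_reals[OF s2, of "''F''"] by (simp add: select_def)
    have tab2: "tab m2 = tab m" "ctab m2 = ctab m"
      using int2[of "''ch''"] real2 by (auto simp: tab_def ctab_def fun_eq_iff)
    let ?R = "\<lambda>j w. merged (Suc w) (tab m ?sp j) (tab m ?sc j) (reals m2 ''g'' (int c)) w"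
    let ?f = "fill merge_cell"
    show "runs (Seq ?f (IWrite ''cur'' (IRead ''par'' (IVar ''c'')) (IVar ''sn''))) m2
      ((n * (Suc W * ((Suc W * 120 + 60) + 12) + 21) + 9) + 6) (merging (Suc k))"
    proof (rule runs_Seq)
      show "runs ?f m2 (n * (Suc W * ((Suc W * 120 + 60) + 12) + 21) + 9) (\<lambda>m'.
        (\<forall>j<n. \<forall>w\<le>W. ?R j w (tab m' ?sn j w) (ctab m' ?sn j w)) \<and> others ?sn m2 m' \<and>
        same ?f m2 m')"
      proof (rule runs_fill[OF r2])
        show "imods merge_cell \<inter> {''n'', ''Q'', ''j'', ''v''} = {}"
          by (simp add: merge_cell_def)
        fix j w m' assume jw: "j < n" "w \<le> W" "ints m' ''j'' 0 = int j" "ints m' ''v'' 0 = int w"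
          and s: "same ?f m2 m'" and o: "others ?sn m2 m'"
        have r': "ready m'"
          using r2 s by (rule ready_same) (simp_all add: fill_def merge_cell_def)
        have ints': "ints m' x = ints ?m1 x" if "x \<in> {''sn'', ''sp'', ''sc'', ''c''}" for x
          using that same_ints[OF s, of x] int2[of x]
          by (elim insertE emptyE) (simp_all add: fill_def merge_cell_def)
        have g': "reals m' ''g'' = reals m2 ''g''"
          using same_reals[OF s, of "''g''"] by (simp add: fill_def merge_cell_def)
        have tab': "tab m' s' j w' = tab m s' j w'" if "s' \<noteq> ?sn" "w' \<le> W" for s' w'
          using o that jw tab2 by (simp add: others_def)
        have "runs merge_cell m' (Suc W * 120 + 60) (\<lambda>m''.
          merged (Suc w) (tab m' ?sp j) (tab m' ?sc j) (reals m' ''g'' (int c)) w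
            (tab m'' ?sn j w) (ctab m'' ?sn j w) \<and> touches ?sn j w m' m'')"
          by (rule runs_merge_cell[OF r']) (use sn sp sc jw ints' in simp_all)
        moreover have "merged (Suc w) (tab m' ?sp j) (tab m' ?sc j) r w v d \<longleftrightarrow>
          merged (Suc w) (tab m ?sp j) (tab m ?sc j) r w v d" for r v d
          using tab' sp sc jw by (intro merged_cong) auto
        ultimately show "runs merge_cell m' (Suc W * 120 + 60) (\<lambda>m''.
          ?R j w (tab m'' ?sn j w) (ctab m'' ?sn j w) \<and> touches ?sn j w m' m'')"
          by (simp add: g')
      qed simp
      fix m3 assume m3: "(\<forall>j<n. \<forall>w\<le>W. ?R j w (tab m3 ?sn j w) (ctab m3 ?sn j w)) \<and>
        others ?sn m2 m3 \<and> same ?f m2 m3"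
      then have s3: "same ?f m2 m3" by blast
      have r3: "ready m3"
        using r2 s3 by (rule ready_same) (simp_all add: fill_def merge_cell_def)
      have ints3: "ints m3 x = ints m2 x" if "x \<in> {''sn'', ''c'', ''cur'', ''bj''}" for x
        using that same_ints[OF s3, of x]
        by (elim insertE emptyE) (simp_all add: fill_def merge_cell_def)
      have g3: "reals m3 ''g'' = reals m2 ''g''"
        using same_reals[OF s3, of "''g''"] by (simp add: fill_def merge_cell_def)
      have old: "tab m3 s' j w = tab m s' j w" "ctab m3 s' j w = ctab m s' j w"
        if "s' \<noteq> ?sn" "j < n" "w \<le> W" for s' j w
        using m3 that tab2 by (simp_all add: others_def)
      let ?m4 = "write_int ''cur'' (int (par c)) (int ?sn) m3"
      have "merging (Suc k) ?m4"
        unfolding merging_def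
      proof (intro conjI allI impI)
        show "ints ?m4 ''cur'' (int x) = int (slot (Suc k) x)" if "x < n" for x
          using I that ints3[of "''cur''"] int2[of "''cur''"] by (simp add: merging_def c_def)
        show "tab ?m4 x j w = base x j w" if "x < n" "j < n" "w \<le> W" for x j w
          using I that old[of x j w] by (simp add: merging_def)
        show "step i ?m4" if i: "i < Suc k" for i
        proof (cases "i = k")
          case True
          have eq: "tab m3 (slot k c) j w = tab m (slot k c) j w"
            "tab m3 (slot k (par c)) j w = tab m (slot k (par c)) j w" if "j < n" "w \<le> W" for j w
            using old that sp sc by auto
          have "merged (Suc w) (tab m3 ?sp j) (tab m3 ?sc j) r w v d \<longleftrightarrow>
            merged (Suc w) (tab m ?sp j) (tab m ?sc j) r w v d" if "j < n" "w \<le> W" for j w r v d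
            using eq that by (intro merged_cong) auto
          then show ?thesis
            using m2 m3 True eq g3 ints3[of "''bj''"]
            unfolding step_def Let_def chosen_def True c_def[symmetric] by auto
        next
          case False
          then have i': "i < k" using i by simp
          then have ne: "n - Suc i \<noteq> c" using k by (simp add: c_def)
          show ?thesis
          proof (rule step_cong)
            show "step i m" using I i' by (simp add: merging_def)
            show "i < n" using i' k by simp
            show "tab ?m4 s j w = tab m s j w \<and> ctab ?m4 s j w = ctab m s j w"
              if "s < n \<or> n + (n - Suc i) \<le> s" "j < n" "w \<le> W" for s j w
              using old[of s j w] that i' k by (auto simp: c_def)
            show "reals ?m4 ''g'' (int (n - Suc i)) = reals m ''g'' (int (n - Suc i))"
              using m2 g3 ne by (auto simp: keeps_def)
            show "ints ?m4 ''bj'' (int (n - Suc i)) = ints m ''bj'' (int (n - Suc i))"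
              using m2 ints3[of "''bj''"] ne by (auto simp: keeps_def)
          qed
        qed
      qed
      moreover have "ints m3 ''c'' 0 = int c" "ints m3 ''sn'' 0 = int ?sn"
        using ints3 int2 by simp_all
      moreover have "ints m3 ''par'' (int c) = int (par c)"
        using r3 c by (simp add: ready_def)
      ultimately show "runs (IWrite ''cur'' (IRead ''par'' (IVar ''c'')) (IVar ''sn'')) m3 6 (merging (Suc k))"
        by (intro runs_flat) simp_all
    qed
  qed
  ultimately have "runs merge_step m (40 + ((n * 112 + 50) +
      ((n * (Suc W * ((Suc W * 120 + 60) + 12) + 21) + 9) + 6))) (merging (Suc k))"
    unfolding merge_step_def by - (erule runs_Seq, simp)
  then show ?thesis by (rule runs_mono) (simp_all add: algebra_simps)
qed

lemma runs_merge:
  assumes rdy: "ready m" and I: "initial n m" and time: "n * (merge_step_time + 12) + 9 \<le> U"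
  shows "runs merge m U (\<lambda>m'. merging n m' \<and> same merge m m')"
  unfolding merge_def
proof (rule runs_For[where Inv = merging and T = merge_step_time])
  let ?c = "For ''i'' (IVar ''n'') merge_step"
  have rdy': "ready m'" if "same ?c m m'" for m'
    using rdy that
    by (rule ready_same) (simp_all add: merge_step_def merge_setup_def select_def fill_def merge_cell_def)
  show "merging 0 m" using I by (simp add: merging_def initial_def)
  show "''i'' \<notin> imods merge_step"
    by (simp add: merge_step_def merge_setup_def select_def fill_def merge_cell_def)
  show "ival (IVar ''n'') m' = int n" if "same ?c m m'" for m'
    using rdy'[OF that] by (simp add: ready_def)
  show "merging k (write_int ''i'' 0 x m')" if "merging k m'" for k m' x
    using that by (simp add: merging_def step_def chosen_def)
  show "runs merge_step m' merge_step_time (merging (Suc k))"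
    if "k < n" "ints m' ''i'' 0 = int k" "merging k m'" "same ?c m m'" for k m'
    using runs_merge_step rdy' that by blast
  show "n * (merge_step_time + itime (IVar ''n'') + 10) + itime (IVar ''n'') + 7 \<le> U"
    using time by (simp add: algebra_simps)
qed

end

section \<open>Reading off the partition\<close>

text \<open>Merging \<open>c\<close> filled slot \<open>n + c\<close>, so the decision about
  \<open>c\<close> is found there, at the index and the budget already fixed for its parent.\<close>

definition trace_step :: com where
  "trace_step =
     Seq (ISet ''c'' (IAdd (IVar ''i'') (IConst 1)))
     (Seq (ISet ''p'' (IRead ''par'' (IVar ''c'')))
     (Seq (ISet ''a'' (IRead ''ch'' (Cell (IAdd (IVar ''n'') (IVar ''c''))
       (IRead ''J'' (IVar ''p'')) (IRead ''B'' (IVar ''p'')))))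
     (Cond (ILess (IVar ''a'') (IConst 0))
       (Seq (IWrite ''J'' (IVar ''c'') (IRead ''bj'' (IVar ''c'')))
       (Seq (IWrite ''B'' (IVar ''c'') (ISub (IVar ''Q'') (IConst 1)))
       (IWrite ''lab'' (IVar ''c'') (IVar ''c''))))
       (Seq (IWrite ''J'' (IVar ''c'') (IRead ''J'' (IVar ''p'')))
       (Seq (IWrite ''B'' (IVar ''c'') (IVar ''a''))
       (Seq (IWrite ''B'' (IVar ''p'') (ISub (IRead ''B'' (IVar ''p'')) (IVar ''a'')))
       (IWrite ''lab'' (IVar ''c'') (IRead ''lab'' (IVar ''p'')))))))))"

definition trace_start :: com where
  "trace_start = Seq (ISet ''J'' (IRead ''bj'' (IConst 0)))
     (Seq (ISet ''B'' (ISub (IVar ''Q'') (IConst 1))) (ISet ''lab'' (IConst 0)))"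

definition trace :: com where
  "trace = Seq trace_start (For ''i'' (ISub (IVar ''n'') (IConst 1)) trace_step)"

definition report :: com where
  "report =
     Seq (For ''i'' (IVar ''n'') (IWrite ''label'' (IRead ''ord'' (IVar ''i'')) (IRead ''lab'' (IVar ''i''))))
     (Seq (Cond (RLess (RRead ''g'' (IConst 0)) (RVar ''big''))
         (ISet ''feasible'' (IConst 1)) (ISet ''feasible'' (IConst 0)))
       (RSet ''cost'' (RRead ''g'' (IConst 0))))"

locale solved = tables +
  fixes m0 :: memory
  assumes ready: "ready m0" and merging: "merging n m0"
    and sv_nonneg: "\<And>x. x < n \<Longrightarrow> 0 \<le> sv x"
    and big_nonneg: "0 \<le> big"
begin

lemma step0: "c < n \<Longrightarrow> step (n - Suc c) m0"
  using merging by (simp add: merging_def)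

lemma slot_child:
  assumes "c < n"
  shows "slot (n - c) = (slot (n - Suc c))(par c := n + c)"
proof -
  have "n - c = Suc (n - Suc c)" "n - Suc (n - Suc c) = c" using assms by auto
  then show ?thesis by simp
qed

lemma chosen0:
  assumes "c < n"
  shows "chosen n (\<lambda>j. tab m0 (slot (n - Suc c) c) j W) c m0"
  using step0[OF assms] assms by (simp add: step_def Let_def Suc_diff_Suc)

lemma merged0:
  assumes "c < n" "j < n" "w \<le> W"
  shows "merged (Suc w) (tab m0 (slot (n - Suc c) (par c)) j) (tab m0 (slot (n - Suc c) c) j)
    (reals m0 ''g'' (int c)) w (tab m0 (slot (n - c) (par c)) j w) (ctab m0 (n + c) j w)"
  using step0[OF assms(1)] assms slot_child[OF assms(1)]
  by (simp add: step_def Let_def Suc_diff_Suc)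

text \<open>After \<open>n - c\<close> merges exactly the nodes from \<open>c\<close> on have been
  merged, so \<open>slot (n - c) x\<close> is where \<open>f c x\<close> is stored.\<close>

sublocale dp: partition_dp n W par wt sv big "\<lambda>c x. tab m0 (slot (n - c) x)"
  "\<lambda>c. reals m0 ''g'' (int c)" "\<lambda>c. nat (ints m0 ''bj'' (int c))" "\<lambda>c. ctab m0 (n + c)"
proof
  show "0 < n" by (rule n_pos)
  show "par c < c" if "0 < c" "c < n" for c using par_less that .
  show "0 \<le> sv x" if "x < n" for x using sv_nonneg that .
  show "0 \<le> big" by (rule big_nonneg)
  show "tab m0 (slot (n - n) x) j w = (if wt x \<le> w \<and> sv x \<le> sv j then 0 else big)"
    if "x < n" "j < n" "w \<le> W" for x j w
    using merging that by (simp add: merging_def base_def)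
  fix c assume c: "c < n"
  show "nat (ints m0 ''bj'' (int c)) < n"
    "reals m0 ''g'' (int c) = sv (nat (ints m0 ''bj'' (int c))) +
      tab m0 (slot (n - Suc c) c) (nat (ints m0 ''bj'' (int c))) W"
    using chosen0[OF c] by (auto simp: chosen_def)
  show "reals m0 ''g'' (int c) \<le> sv j + tab m0 (slot (n - Suc c) c) j W" if "j < n" for j
    using chosen0[OF c] that by (auto simp: chosen_def)
  show "tab m0 (slot (n - c) x) = tab m0 (slot (n - Suc c) x)" if "x \<noteq> par c" for x
    using slot_child[OF c] that by simp
  fix j w assume jw: "j < n" "w \<le> W"
  note m = merged0[OF c jw, unfolded merged_def]
  show "tab m0 (slot (n - c) (par c)) j w
    \<le> tab m0 (slot (n - Suc c) (par c)) j w + reals m0 ''g'' (int c)"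
    using m by blast
  show "tab m0 (slot (n - c) (par c)) j w
    \<le> tab m0 (slot (n - Suc c) (par c)) j (w - u) + tab m0 (slot (n - Suc c) c) j u"
    if "u \<le> w" for u
    using m that by (simp add: less_Suc_eq_le)
  show "ctab m0 (n + c) j w = - 1 \<and> tab m0 (slot (n - c) (par c)) j w =
      tab m0 (slot (n - Suc c) (par c)) j w + reals m0 ''g'' (int c) \<or>
    (\<exists>u\<le>w. ctab m0 (n + c) j w = int u \<and> tab m0 (slot (n - c) (par c)) j w =
      tab m0 (slot (n - Suc c) (par c)) j (w - u) + tab m0 (slot (n - Suc c) c) j u)"
    using m by blast
qed

text \<open>The root is assigned before the loop, so after \<open>k\<close> rounds the nodes 0 to
  \<open>k\<close> are done; this explains \<open>Suc k\<close> here and the \<open>n - 1\<close>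
  rounds of the loop.\<close>

definition tracing :: "nat \<Rightarrow> memory \<Rightarrow> bool" where
  "tracing k m \<longleftrightarrow> (\<exists>J B lab. dp.traced (Suc k) J B lab \<and>
     (\<forall>x\<le>k. ints m ''J'' (int x) = int (J x) \<and> ints m ''B'' (int x) = int (B x) \<and>
        ints m ''lab'' (int x) = int (lab x)))"

lemma runs_trace_step:
  assumes k: "Suc k < n" "ints m ''i'' 0 = int k"
    and eq: "ready m" "ints m ''ch'' = ints m0 ''ch''" "ints m ''bj'' = ints m0 ''bj''"
    and I: "tracing k m"
  shows "runs trace_step m 80 (tracing (Suc k))"
proof (rule runs_flat)
  let ?c = "Suc k" and ?p = "par (Suc k)"
  from I obtain J B lab where t: "dp.traced (Suc k) J B lab"
    and M: "\<And>x. x \<le> k \<Longrightarrow> ints m ''J'' (int x) = int (J x) \<and> ints m ''B'' (int x) = int (B x) \<and>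
      ints m ''lab'' (int x) = int (lab x)"
    unfolding tracing_def by blast
  have p: "?p \<le> k" using par_less[of ?c] k by simp
  have J: "J ?p < n" and B: "B ?p \<le> W"
    using t p dp.traced_budget[OF t] unfolding dp.traced_def by auto
  define d where "d = ctab m0 (n + ?c) (J ?p) (B ?p)"
  have parc: "ints m ''par'' (int ?c) = int ?p" "ints m ''n'' 0 = int n" "ints m ''Q'' 0 = int W + 1"
    using eq(1) k unfolding ready_def by blast+
  define m1 where "m1 = write_int ''p'' 0 (int ?p) (write_int ''c'' 0 (int ?c) m)"
  define m2 where "m2 = write_int ''a'' 0 d m1"
  have r1: "ready m1" using eq(1) by (simp add: ready_def m1_def)
  have "ival (Cell (IAdd (IVar ''n'') (IVar ''c'')) (IRead ''J'' (IVar ''p'')) (IRead ''B'' (IVar ''p''))) m1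
    = int (adr (n + ?c) (J ?p) (B ?p))"
    using r1 k p J M[OF p] parc by (intro ival_Cell) (simp_all add: m1_def)
  then have run: "run trace_step m = (if d < 0
    then write_int ''lab'' (int ?c) (int ?c) (write_int ''B'' (int ?c) (int W)
      (write_int ''J'' (int ?c) (ints m ''bj'' (int ?c)) m2))
    else write_int ''lab'' (int ?c) (int (lab ?p)) (write_int ''B'' (int ?p) (int (B ?p) - d)
      (write_int ''B'' (int ?c) d (write_int ''J'' (int ?c) (int (J ?p)) m2))))"
    using k parc p M[OF p] eq(2) unfolding m2_def d_def
    by (auto simp: trace_step_def m1_def ctab_def add.commute)
  have c: "0 < ?c" "?c < n" using k by auto
  have bj: "0 \<le> ints m0 ''bj'' (int ?c)"
    using chosen0[of ?c] k by (auto simp: chosen_def)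
  have m2: "ints m2 ''J'' = ints m ''J''" "ints m2 ''B'' = ints m ''B''" "ints m2 ''lab'' = ints m ''lab''"
    by (simp_all add: m2_def m1_def)
  show "tracing (Suc k) (run trace_step m)"
  proof (cases "d < 0")
    case True
    \<comment> \<open>The program tests only the sign; by \<open>f_choice\<close> no negative value
      other than -1 is ever recorded.\<close>
    then have "d = - 1"
      using dp.f_choice[OF c J B] unfolding d_def by auto
    then have t': "dp.traced (Suc ?c) (J(?c := nat (ints m0 ''bj'' (int ?c)))) (B(?c := W)) (lab(?c := ?c))"
      by (intro dp.traced_cut[OF t c]) (simp add: d_def)
    show ?thesis
      unfolding tracing_def run
      by (rule exI, rule exI, rule exI, rule conjI[OF t'])
        (use True M m2 eq(3) bj in \<open>auto simp: le_Suc_eq\<close>)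
  next
    case False
    then obtain u where u: "d = int u"
      by (metis nonneg_int_cases not_le)
    note t' = dp.traced_keep[OF t c u[unfolded d_def]]
    show ?thesis
      unfolding tracing_def run
      by (rule exI, rule exI, rule exI, rule conjI[OF t'(1)])
        (use False M M[OF p] m2 u p t'(2) in \<open>auto simp: le_Suc_eq\<close>)
  qed
qed (simp_all add: trace_step_def Cell_def)

lemma runs_trace: "runs trace m0 (n * 94 + 50) (\<lambda>m. tracing (n - 1) m \<and> same trace m0 m)"
proof (rule runs_same)
  let ?m = "write_int ''lab'' 0 0 (write_int ''B'' 0 (int W)
    (write_int ''J'' 0 (ints m0 ''bj'' 0) m0))"
  let ?loop = "For ''i'' (ISub (IVar ''n'') (IConst 1)) trace_step"
  have "runs trace_start m0 30 (\<lambda>m. m = ?m)"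
    using ready by (intro runs_flat) (simp_all add: trace_start_def ready_def)
  moreover have "runs ?loop ?m ((n - 1) * 94 + 11) (\<lambda>m. tracing (n - 1) m \<and> same ?loop ?m m)"
  proof (rule runs_For[where Inv = tracing and T = 80])
    have "0 \<le> ints m0 ''bj'' 0" using chosen0[of 0] n_pos by (auto simp: chosen_def)
    moreover have "dp.traced 1 (\<lambda>_. nat (ints m0 ''bj'' 0)) (\<lambda>_. W) (\<lambda>_. 0)"
      by (rule dp.traced_start) simp_all
    ultimately show "tracing 0 ?m"
      unfolding tracing_def by (intro exI conjI) (simp, simp)
    show "''i'' \<notin> imods trace_step" by (simp add: trace_step_def)
    show "ival (ISub (IVar ''n'') (IConst 1)) m = int (n - 1)" if "same ?loop ?m m" for m
      using same_ints[OF that, of "''n''"] ready n_pos by (simp add: trace_step_def ready_def)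
    show "tracing k (write_int ''i'' 0 a m)" if "tracing k m" for k m a
      using that by (simp add: tracing_def)
    fix k m assume k: "k < n - 1" "ints m ''i'' 0 = int k" "tracing k m" and s: "same ?loop ?m m"
    have "ready ?m" using ready by (simp add: ready_def)
    then have "ready m" using s by (rule ready_same) (simp_all add: trace_step_def)
    moreover have "ints m ''ch'' = ints m0 ''ch''" "ints m ''bj'' = ints m0 ''bj''"
      using same_ints[OF s, of "''ch''"] same_ints[OF s, of "''bj''"] by (simp_all add: trace_step_def)
    ultimately show "runs trace_step m 80 (tracing (Suc k))"
      using k by (intro runs_trace_step) auto
  qed simp_all
  ultimately have "runs trace m0 (30 + ((n - 1) * 94 + 11)) (tracing (n - 1))"
    unfolding trace_def by (elim runs_Seq) (auto elim: runs_mono)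
  then show "runs trace m0 (n * 94 + 50) (tracing (n - 1))"
    by (rule runs_mono) auto
qed

lemma runs_report:
  assumes m: "same trace m0 m" and t: "tracing (n - 1) m"
    and ord: "inj_on ord {..<n}" "\<And>x. x < n \<Longrightarrow> ints m0 ''ord'' (int x) = int (ord x)"
  shows "runs report m (n * 20 + 40) (\<lambda>m'. \<exists>J B lab. dp.traced n J B lab \<and>
    (\<forall>x<n. ints m' ''label'' (int (ord x)) = int (lab x)) \<and>
    ints m' ''feasible'' 0 = (if reals m0 ''g'' 0 < big then 1 else 0) \<and>
    reals m' ''cost'' 0 = reals m0 ''g'' 0)"
proof -
  from t n_pos obtain J B lab where tr: "dp.traced n J B lab"
    and lab: "\<And>x. x < n \<Longrightarrow> ints m ''lab'' (int x) = int (lab x)"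
    by (auto simp: tracing_def less_Suc_eq_le)
  let ?I = "\<lambda>k m'. \<forall>x<k. ints m' ''label'' (int (ord x)) = int (lab x)"
  let ?body = "IWrite ''label'' (IRead ''ord'' (IVar ''i'')) (IRead ''lab'' (IVar ''i''))"
  let ?loop = "For ''i'' (IVar ''n'') ?body"
  have r: "ready m"
    using ready m by (rule ready_same) (simp_all add: trace_def trace_start_def trace_step_def)
  have o: "ints m ''ord'' = ints m0 ''ord''" and g: "reals m ''g'' = reals m0 ''g''"
    using same_ints[OF m, of "''ord''"] same_reals[OF m, of "''g''"]
    by (simp_all add: trace_def trace_start_def trace_step_def)
  have "runs ?loop m (n * 20 + 9) (\<lambda>m'. ?I n m' \<and> same ?loop m m')"
  proof (rule runs_For[where Inv = ?I and T = 8])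
    show "ival (IVar ''n'') m' = int n" if "same ?loop m m'" for m'
      using same_ints[OF that, of "''n''"] r by (simp add: ready_def)
    fix k m' assume k: "k < n" "ints m' ''i'' 0 = int k" and I: "?I k m'" and s: "same ?loop m m'"
    have "ints m' ''ord'' = ints m ''ord''" "ints m' ''lab'' = ints m ''lab''"
      using same_ints[OF s, of "''ord''"] same_ints[OF s, of "''lab''"] by simp_all
    then have "run ?body m' = write_int ''label'' (int (ord k)) (int (lab k)) m'"
      using o k lab ord(2) by simp
    moreover have "ord x \<noteq> ord k" if "x < k" for x
      using inj_onD[OF ord(1), of x k] that k by auto
    ultimately show "runs ?body m' 8 (?I (Suc k))"
      using I by (intro runs_flat) (auto simp: less_Suc_eq)
  qed simp_all
  moreover have "runs (Seq (Cond (RLess (RRead ''g'' (IConst 0)) (RVar ''big''))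
         (ISet ''feasible'' (IConst 1)) (ISet ''feasible'' (IConst 0)))
       (RSet ''cost'' (RRead ''g'' (IConst 0)))) m' 20 (\<lambda>m'. ?I n m' \<and>
       ints m' ''feasible'' 0 = (if reals m0 ''g'' 0 < big then 1 else 0) \<and>
       reals m' ''cost'' 0 = reals m0 ''g'' 0)" if "?I n m' \<and> same ?loop m m'" for m'
  proof -
    have "reals m' ''g'' = reals m ''g''" "reals m' ''big'' = reals m ''big''"
      using that same_reals[of ?loop m m'] by simp_all
    then show ?thesis
      using that g r by (intro runs_flat) (simp_all add: ready_def)
  qed
  ultimately have "runs report m ((n * 20 + 9) + 20) (\<lambda>m'. ?I n m' \<and>
       ints m' ''feasible'' 0 = (if reals m0 ''g'' 0 < big then 1 else 0) \<and>
       reals m' ''cost'' 0 = reals m0 ''g'' 0)"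
    unfolding report_def by (rule runs_Seq)
  then show ?thesis
    by (rule runs_mono) (use tr in auto)
qed

end

section \<open>Budget, search order and addresses\<close>

definition count_budget :: com where
  "count_budget = Seq (Seq (ISet ''Q'' (IConst 1)) (RSet ''r'' (RConst 1)))
     (Loop (BNot (RLess (RVar ''w0'') (RVar ''r'')))
       (Seq (ISet ''Q'' (IAdd (IVar ''Q'') (IConst 1))) (RSet ''r'' (RAdd (RVar ''r'') (RConst 1)))))"

text \<open>The real counter \<open>r\<close> runs one ahead of the budgets known to fit, so the
  loop stops when \<open>r\<close> exceeds the threshold, and \<open>Q\<close> is then the number
  \<open>W + 1\<close> of budgets 0 to \<open>W\<close>.\<close>

lemma runs_count_budget:
  assumes thr: "0 \<le> reals m ''w0'' 0"
  defines "W \<equiv> nat \<lfloor>reals m ''w0'' 0\<rfloor>"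
  shows "runs count_budget m (W * 30 + 30)
    (\<lambda>m'. ints m' ''Q'' 0 = int W + 1 \<and> same count_budget m m')"
proof (rule runs_same)
  let ?b = "BNot (RLess (RVar ''w0'') (RVar ''r''))"
  let ?c = "Seq (ISet ''Q'' (IAdd (IVar ''Q'') (IConst 1))) (RSet ''r'' (RAdd (RVar ''r'') (RConst 1)))"
  let ?I = "\<lambda>k m'. ints m' ''Q'' 0 = int k + 1 \<and> reals m' ''r'' 0 = real k + 1"
  let ?m = "write_real ''r'' 0 1 (write_int ''Q'' 0 1 m)"
  have W: "real W \<le> reals m ''w0'' 0" "reals m ''w0'' 0 < real W + 1"
    using thr by (simp_all add: W_def)
  have w0: "reals m' ''w0'' 0 = reals m ''w0'' 0" if "same ?c ?m m'" for m'
    using same_reals[OF that, of "''w0''"] by simp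
  have "runs (Seq (ISet ''Q'' (IConst 1)) (RSet ''r'' (RConst 1))) m 10 (\<lambda>m'. m' = ?m)"
    by (rule runs_flat) simp_all
  moreover have "runs (Loop ?b ?c) ?m (W * (12 + btime ?b + 1) + btime ?b + 1) (?I W)"
  proof (rule runs_Loop)
    show "?I 0 ?m" by simp
    fix k m' assume k: "k < W" and I: "?I k m'" and s: "same ?c ?m m'"
    have "real k + 1 \<le> real W" using k by linarith
    then have "bval ?b m'" using W(1) I w0[OF s] by simp
    moreover have "runs ?c m' 12 (?I (Suc k))"
      using I by (intro runs_flat) simp_all
    ultimately show "bval ?b m' \<and> runs ?c m' 12 (?I (Suc k))" ..
  next
    fix m' assume "?I W m'" "same ?c ?m m'"
    then show "\<not> bval ?b m'" using W(2) w0 by simp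
  qed
  ultimately have "runs count_budget m (10 + (W * (12 + btime ?b + 1) + btime ?b + 1)) (?I W)"
    unfolding count_budget_def by - (erule runs_Seq, simp)
  then show "runs count_budget m (W * 30 + 30) (\<lambda>m'. ints m' ''Q'' 0 = int W + 1)"
    by (rule runs_mono) simp_all
qed

section \<open>Enumerating the nodes with parents first\<close>

definition visit :: "vname \<Rightarrow> vname \<Rightarrow> com" where
  "visit a b =
     Cond (BAnd (BNot (IEq (IRead ''pos'' (IRead a (IVar ''e''))) (IConst 0)))
         (IEq (IRead ''pos'' (IRead b (IVar ''e''))) (IConst 0)))
       (Seq (IWrite ''ord'' (IVar ''cnt'') (IRead b (IVar ''e'')))
       (Seq (IWrite ''par'' (IVar ''cnt'') (ISub (IRead ''pos'' (IRead a (IVar ''e''))) (IConst 1)))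
       (Seq (ISet ''cnt'' (IAdd (IVar ''cnt'') (IConst 1)))
       (IWrite ''pos'' (IRead b (IVar ''e'')) (IVar ''cnt'')))))
       Skip"

definition explore_start :: com where
  "explore_start = Seq (ISet ''ord'' (IConst 1)) (Seq (ISet ''par'' (IConst 0))
     (Seq (ISet ''cnt'' (IConst 1)) (IWrite ''pos'' (IConst 1) (IConst 1))))"

definition scan :: com where
  "scan = For ''e'' (IVar ''m'') (Seq (visit ''fst'' ''snd'') (visit ''snd'' ''fst''))"

text \<open>By connectedness, a scan that starts with some node unseen adds a node, so
  \<open>n\<close> scans are enough. With at most \<open>n\<close> edges they take O(n^2) steps,
  which the claimed time allows, and no adjacency lists have to be built.\<close>

definition explore :: com where
  "explore = Seq explore_start (For ''i'' (IVar ''n'') scan)"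

text \<open>Positions are stored with offset 1, so that 0 marks the nodes not seen yet.\<close>

definition explored_by ::
    "nat set \<Rightarrow> nat set set \<Rightarrow> nat \<Rightarrow> (nat \<Rightarrow> nat) \<Rightarrow> (nat \<Rightarrow> nat) \<Rightarrow> memory \<Rightarrow> bool" where
  "explored_by N E k ord par m \<longleftrightarrow> search_order N E k ord par \<and> par 0 = 0 \<and>
     ints m ''cnt'' 0 = int k \<and>
     (\<forall>x<k. ints m ''ord'' (int x) = int (ord x) \<and> ints m ''par'' (int x) = int (par x) \<and>
        ints m ''pos'' (int (ord x)) = int x + 1) \<and>
     (\<forall>v\<in>N - ord ` {..<k}. ints m ''pos'' (int v) = 0)"

definition explored :: "nat set \<Rightarrow> nat set set \<Rightarrow> memory \<Rightarrow> bool" where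
  "explored N E m \<longleftrightarrow> (\<exists>k ord par. explored_by N E k ord par m)"

definition seen :: "nat set \<Rightarrow> memory \<Rightarrow> nat set" where
  "seen N m = {v \<in> N. ints m ''pos'' (int v) \<noteq> 0}"

lemma seen_explored_by:
  assumes "explored_by N E k ord par m"
  shows "seen N m = ord ` {..<k}" "card (seen N m) = k"
proof -
  have so: "search_order N E k ord par" using assms by (simp add: explored_by_def)
  show "seen N m = ord ` {..<k}"
    using assms so unfolding seen_def explored_by_def search_order_def by fastforce
  then show "card (seen N m) = k"
    using so by (simp add: search_order_def card_image)
qed

lemma explored_by_indep:
  assumes "x \<notin> {''cnt'', ''ord'', ''par'', ''pos''}"
  shows "explored_by N E k ord par (write_int x i a m) = explored_by N E k ord par m"
proof -
  have "ints (write_int x i a m) y = ints m y" if "y \<in> {''cnt'', ''ord'', ''par'', ''pos''}" for y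
    using assms that by (cases "y = x") simp_all
  then show ?thesis by (simp add: explored_by_def del: ints_write_int)
qed

text \<open>A new node is appended at the end, so its parent, already seen, has a smaller position.
  The counter is increased before it is stored in \<open>pos\<close>, which produces the offset
  1.\<close>

lemma run_visit:
  assumes ex: "explored N E m"
    and xy: "x \<notin> {''cnt'', ''ord'', ''par'', ''pos''}" "y \<notin> {''cnt'', ''ord'', ''par'', ''pos''}"
    and ab: "a \<in> N" "b \<in> N" "{a, b} \<in> E"
    and m: "ints m x (ints m ''e'' 0) = int a" "ints m y (ints m ''e'' 0) = int b"
  defines "m' \<equiv> run (visit x y) m"
  shows "explored N E m' \<and> seen N m \<subseteq> seen N m' \<and> (a \<in> seen N m \<longrightarrow> b \<in> seen N m')"
proof (cases "a \<in> seen N m \<and> b \<notin> seen N m")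
  case False
  then have "m' = m" using m ab by (auto simp: m'_def visit_def seen_def)
  then show ?thesis using False ex by auto
next
  case True
  from ex obtain k ord par where k: "explored_by N E k ord par m" by (auto simp: explored_def)
  note seen = seen_explored_by[OF k]
  from True seen obtain z where z: "z < k" "a = ord z" by auto
  have new: "b \<notin> ord ` {..<k}" using True seen by simp
  have pos: "ints m ''pos'' (int a) = int z + 1" "ints m ''pos'' (int b) = 0"
    "ints m ''cnt'' 0 = int k" and so: "search_order N E k ord par"
    using k z new ab by (auto simp: explored_by_def)
  let ?m = "write_int ''pos'' (int b) (int k + 1) (write_int ''cnt'' 0 (int k + 1)
    (write_int ''par'' (int k) (int z) (write_int ''ord'' (int k) (int b) m)))"
  have m': "m' = ?m"
    using m pos xy by (auto simp: m'_def visit_def)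
  have ab': "{b, ord z} \<in> E" using ab z by (simp add: insert_commute)
  have lt: "ord w \<noteq> b" if "w < k" for w using new that by auto
  have "search_order N E (Suc k) (ord(k := b)) (par(k := z))"
    unfolding search_order_def
  proof (intro conjI allI impI)
    have "inj_on ord {..<k}" using so by (simp add: search_order_def)
    then have "inj_on (ord(k := b)) {..<k}" by (simp add: inj_on_def)
    moreover have "(ord(k := b)) ` {..<k} = ord ` {..<k}" by auto
    ultimately show "inj_on (ord(k := b)) {..<Suc k}"
      using new by (simp add: lessThan_Suc)
    show "(ord(k := b)) ` {..<Suc k} \<subseteq> N"
      using so ab by (auto simp: search_order_def less_Suc_eq)
    show "(par(k := z)) c < c" if "0 < c \<and> c < Suc k" for c
      using so z that by (auto simp: search_order_def less_Suc_eq)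
    show "{(ord(k := b)) c, (ord(k := b)) ((par(k := z)) c)} \<in> E" if "0 < c \<and> c < Suc k" for c
    proof (cases "c = k")
      case True
      then show ?thesis using z ab' by simp
    next
      case False
      then have "par c < c" "c < k" "{ord c, ord (par c)} \<in> E"
        using so that by (auto simp: search_order_def)
      then show ?thesis by simp
    qed
  qed simp
  then have "explored_by N E (Suc k) (ord(k := b)) (par(k := z)) ?m"
    using k lt z unfolding explored_by_def by (auto simp: less_Suc_eq)
  then have "explored N E m'" unfolding m' explored_def by blast
  moreover have "seen N m' = insert b (seen N m)"
    using ab by (auto simp: m' seen_def)
  ultimately show ?thesis by auto
qed

text \<open>Progress is measured against the set seen before the scan, which stays fixed while the
  scan itself adds nodes. Each edge is tried in both directions because the list orients edges
  arbitrarily.\<close>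

lemma runs_scan:
  assumes ex: "explored (nodes I) (edges I) m"
    and sub: "\<And>u v. (u, v) \<in> set (edge_list I) \<Longrightarrow> u \<in> nodes I \<and> v \<in> nodes I"
    and len: "ints m ''m'' 0 = int (length (edge_list I))"
    and edge: "\<And>k. k < length (edge_list I) \<Longrightarrow>
      ints m ''fst'' (int k) = int (fst (edge_list I ! k)) \<and>
      ints m ''snd'' (int k) = int (snd (edge_list I ! k))"
  shows "runs scan m (length (edge_list I) * 120 + 9) (\<lambda>m'. explored (nodes I) (edges I) m' \<and>
    seen (nodes I) m \<subseteq> seen (nodes I) m' \<and>
    (\<forall>u\<in>seen (nodes I) m. \<forall>v. {u, v} \<in> edges I \<longrightarrow> v \<in> seen (nodes I) m'))"
proof -
  let ?N = "nodes I" and ?E = "edges I" and ?es = "edge_list I"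
  let ?S = "seen ?N m"
  let ?body = "Seq (visit ''fst'' ''snd'') (visit ''snd'' ''fst'')"
  let ?I = "\<lambda>k m'. explored ?N ?E m' \<and> ?S \<subseteq> seen ?N m' \<and>
    (\<forall>i<k. (fst (?es ! i) \<in> ?S \<longrightarrow> snd (?es ! i) \<in> seen ?N m') \<and>
       (snd (?es ! i) \<in> ?S \<longrightarrow> fst (?es ! i) \<in> seen ?N m'))"
  have "runs scan m (length ?es * 120 + 9) (\<lambda>m'. ?I (length ?es) m' \<and> same scan m m')"
    unfolding scan_def
  proof (rule runs_For[where Inv = ?I and T = 100])
    let ?c = "For ''e'' (IVar ''m'') ?body"
    show "?I 0 m" using ex by simp
    show "''e'' \<notin> imods ?body" by (simp add: visit_def)
    show "ival (IVar ''m'') m' = int (length ?es)" if "same ?c m m'" for m'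
      using same_ints[OF that, of "''m''"] len by (simp add: visit_def)
    show "?I k (write_int ''e'' 0 x m')" if "?I k m'" for k m' x
      using that by (simp add: seen_def explored_def explored_by_indep)
    fix k m' assume k: "k < length ?es" "ints m' ''e'' 0 = int k" and I: "?I k m'" and s: "same ?c m m'"
    let ?u = "fst (?es ! k)" and ?v = "snd (?es ! k)"
    have uv: "?u \<in> ?N" "?v \<in> ?N" "{?u, ?v} \<in> ?E" "{?v, ?u} \<in> ?E"
      using sub[of ?u ?v] nth_mem[OF k(1)] by (force simp: edges_def insert_commute)+
    have ints: "ints m'' x (ints m'' ''e'' 0) = ints m x (int k)"
      if "x \<in> {''fst'', ''snd''}" "same ?body m' m''" for x m''
      using that k same_ints[OF that(2), of x] same_ints[OF that(2), of "''e''"] same_ints[OF s, of x]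
      by (auto simp: visit_def)
    let ?m1 = "run (visit ''fst'' ''snd'') m'" and ?m2 = "run ?body m'"
    have s1: "same ?body m' m'" "same ?body m' ?m1"
      by (simp_all add: same_def visit_def)
    have 1: "explored ?N ?E ?m1 \<and> seen ?N m' \<subseteq> seen ?N ?m1 \<and> (?u \<in> seen ?N m' \<longrightarrow> ?v \<in> seen ?N ?m1)"
      by (rule run_visit) (use I uv ints[OF _ s1(1)] edge[OF k(1)] in simp_all)
    have 2: "explored ?N ?E ?m2 \<and> seen ?N ?m1 \<subseteq> seen ?N ?m2 \<and> (?v \<in> seen ?N ?m1 \<longrightarrow> ?u \<in> seen ?N ?m2)"
      unfolding run.simps
      by (rule run_visit) (use 1 uv ints[OF _ s1(2)] edge[OF k(1)] in simp_all)
    have "?I (Suc k) ?m2"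
      using I 1 2 by (auto simp: less_Suc_eq simp del: run.simps)
    then show "runs ?body m' 100 (?I (Suc k))"
      by (intro runs_flat) (simp_all add: visit_def)
  qed simp
  then show ?thesis
  proof (rule runs_mono)
    fix m' assume m': "?I (length ?es) m' \<and> same scan m m'"
    have "v \<in> seen ?N m'" if uv: "u \<in> ?S" "{u, v} \<in> ?E" for u v
    proof -
      from uv(2) obtain i where i: "i < length ?es" "{u, v} = {fst (?es ! i), snd (?es ! i)}"
        by (auto simp: edges_def in_set_conv_nth)
      then have "u = fst (?es ! i) \<and> v = snd (?es ! i) \<or> u = snd (?es ! i) \<and> v = fst (?es ! i)"
        by (auto simp: doubleton_eq_iff)
      then show ?thesis using m' i uv(1) by blast
    qed
    then show "explored ?N ?E m' \<and> ?S \<subseteq> seen ?N m' \<and>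
      (\<forall>u\<in>?S. \<forall>v. {u, v} \<in> ?E \<longrightarrow> v \<in> seen ?N m')"
      using m' by blast
  qed simp
qed

lemma runs_explore:
  assumes valid: "valid_instance I"
    and input: "ints m ''n'' 0 = int (num_nodes I)" "ints m ''m'' 0 = int (length (edge_list I))"
      "\<And>k. k < length (edge_list I) \<Longrightarrow>
        ints m ''fst'' (int k) = int (fst (edge_list I ! k)) \<and>
        ints m ''snd'' (int k) = int (snd (edge_list I ! k))"
      "\<And>k. ints m ''pos'' k = 0"
  shows "runs explore m (num_nodes I * (length (edge_list I) * 120 + 21) + 40)
    (\<lambda>m'. (\<exists>ord par. explored_by (nodes I) (edges I) (num_nodes I) ord par m') \<and> same explore m m')"
proof (rule runs_same)
  let ?N = "nodes I" and ?E = "edges I" and ?n = "num_nodes I"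
  let ?T = "length (edge_list I) * 120 + 9"
  let ?I = "\<lambda>k m'. explored ?N ?E m' \<and> (seen ?N m' = ?N \<or> Suc k \<le> card (seen ?N m'))"
  let ?m = "write_int ''pos'' 1 1 (write_int ''cnt'' 0 1 (write_int ''par'' 0 0 (write_int ''ord'' 0 1 m)))"
  let ?loop = "For ''i'' (IVar ''n'') scan"
  have conn: "connected_nodes ?E ?N" and E: "\<And>e. e \<in> ?E \<Longrightarrow> e \<subseteq> ?N"
    using valid by (auto simp: valid_instance_def is_tree_def simple_graph_def)
  then have n: "0 < ?n" by (auto simp: connected_nodes_def nodes_def)
  have sub: "u \<in> ?N \<and> v \<in> ?N" if "(u, v) \<in> set (edge_list I)" for u v
    using E[of "{u, v}"] that by (force simp: edges_def)
  have "explored_by ?N ?E 1 (\<lambda>_. 1) (\<lambda>_. 0) ?m"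
    using n input(4) by (auto simp: explored_by_def search_order_def nodes_def inj_on_def)
  then have start: "?I 0 ?m"
    using seen_explored_by(2) unfolding explored_def by fastforce
  have "runs explore_start m 20 (\<lambda>m'. m' = ?m)"
    by (rule runs_flat) (simp_all add: explore_start_def)
  moreover have "runs ?loop ?m (?n * (?T + 12) + 9) (\<lambda>m'. ?I ?n m' \<and> same ?loop ?m m')"
  proof (rule runs_For[where Inv = ?I and T = ?T])
    show "?I 0 ?m" by (fact start)
    show "''i'' \<notin> imods scan" by (simp add: scan_def visit_def)
    show "ival (IVar ''n'') m' = int ?n" if "same ?loop ?m m'" for m'
      using same_ints[OF that, of "''n''"] input by (simp add: scan_def visit_def)
    show "?I k (write_int ''i'' 0 x m')" if "?I k m'" for k m' x
      using that by (simp add: seen_def explored_def explored_by_indep)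
    fix k m' assume I: "?I k m'" and s: "same ?loop ?m m'"
    have ints: "ints m' x = ints m x" if "x \<in> {''m'', ''fst'', ''snd''}" for x
      using that same_ints[OF s, of x] by (auto simp: scan_def visit_def)
    have "runs scan m' ?T (\<lambda>m''. explored ?N ?E m'' \<and> seen ?N m' \<subseteq> seen ?N m'' \<and>
      (\<forall>u\<in>seen ?N m'. \<forall>v. {u, v} \<in> ?E \<longrightarrow> v \<in> seen ?N m''))"
      by (rule runs_scan) (use I sub ints input in simp_all)
    then show "runs scan m' ?T (?I (Suc k))"
    proof (rule runs_mono)
      fix m'' assume m'': "explored ?N ?E m'' \<and> seen ?N m' \<subseteq> seen ?N m'' \<and>
        (\<forall>u\<in>seen ?N m'. \<forall>v. {u, v} \<in> ?E \<longrightarrow> v \<in> seen ?N m'')"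
      have fin: "finite (seen ?N m'')" and sN: "seen ?N m'' \<subseteq> ?N" "seen ?N m' \<subseteq> ?N"
        by (auto simp: seen_def nodes_def)
      show "?I (Suc k) m''"
      proof (cases "seen ?N m' = seen ?N m''")
        case True
        \<comment> \<open>If a scan adds nothing, the seen nodes form a nonempty set closed under
          edges, which by connectedness is the whole node set.\<close>
        have "card (seen ?N m') \<noteq> 0" using I n by (auto simp: nodes_def)
        then obtain s where "s \<in> seen ?N m'" by fastforce
        then have "seen ?N m' = ?N"
          using m'' True sN by (intro connected_nodes_closed[OF conn]) auto
        then show ?thesis using True m'' by simp
      next
        case False
        then have "card (seen ?N m') < card (seen ?N m'')"
          using m'' fin by (intro psubset_card_mono) auto
        moreover have "seen ?N m' \<noteq> ?N" using False m'' sN by blast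
        ultimately show ?thesis using I m'' by auto
      qed
    qed simp
  qed simp
  ultimately have "runs explore m (20 + (?n * (?T + 12) + 9)) (?I ?n)"
    unfolding explore_def by - (erule runs_Seq, auto elim: runs_mono)
  then show "runs explore m (?n * (length (edge_list I) * 120 + 21) + 40)
    (\<lambda>m'. \<exists>ord par. explored_by ?N ?E ?n ord par m')"
  proof (rule runs_mono)
    fix m' assume I: "?I ?n m'"
    have "card (seen ?N m') \<le> card ?N" by (intro card_mono) (auto simp: seen_def nodes_def)
    then have "seen ?N m' = ?N" using I by (auto simp: nodes_def)
    moreover obtain k ord par where k: "explored_by ?N ?E k ord par m'"
      using I by (auto simp: explored_def)
    ultimately have "k = ?n" using seen_explored_by(2)[OF k] by (simp add: nodes_def)
    then show "\<exists>ord par. explored_by ?N ?E ?n ord par m'" using k by blast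
  qed (simp add: algebra_simps)
qed

text \<open>The list has no repeated edges and every edge joins some node to its parent. This turns
  the length of the list into \<open>n\<close> in the running time.\<close>

lemma edge_list_length:
  assumes valid: "valid_instance I" and so: "search_order (nodes I) (edges I) (num_nodes I) ord par"
  shows "length (edge_list I) \<le> num_nodes I"
proof -
  let ?n = "num_nodes I"
  have inj: "inj_on ord {..<?n}" and sub: "ord ` {..<?n} \<subseteq> nodes I"
    using so by (simp_all add: search_order_def)
  have V: "ord ` {..<?n} = nodes I"
    using inj sub by (intro card_subset_eq) (auto simp: nodes_def card_image)
  have "is_tree (nodes I) (edges I)" using valid by (simp add: valid_instance_def)
  from tree_edges_eq[OF this so V[symmetric]] have "card (edges I) \<le> card {1..<?n}"
    by (simp only: card_image_le finite_atLeastLessThan)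
  moreover have "card (edges I) = length (edge_list I)"
    using valid distinct_card[of "map (\<lambda>(u, v). {u, v}) (edge_list I)"]
    by (simp add: edges_def valid_instance_def)
  ultimately show ?thesis by simp
qed

section \<open>Data in search order and address offsets\<close>

definition prepare_row :: com where
  "prepare_row =
     Seq (IWrite ''pw'' (IVar ''i'') (IRead ''w'' (IRead ''ord'' (IVar ''i''))))
     (Seq (RWrite ''ps'' (IVar ''i'') (RRead ''s'' (IRead ''ord'' (IVar ''i''))))
     (Seq (RSet ''big'' (RAdd (RVar ''big'') (RRead ''s'' (IRead ''ord'' (IVar ''i'')))))
     (Seq (IWrite ''ro'' (IVar ''i'') (IVar ''nq'')) (ISet ''nq'' (IAdd (IVar ''nq'') (IVar ''Q''))))))"

text \<open>After the rows, \<open>nq\<close> has grown to the table size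
  \<open>n * (W + 1)\<close>. There are \<open>2 * n\<close> regions: one for the initial table of
  each node and one for each merge.\<close>

definition prepare_slots :: com where
  "prepare_slots = For ''i'' (IAdd (IVar ''n'') (IVar ''n''))
     (Seq (IWrite ''off'' (IVar ''i'') (IVar ''a'')) (ISet ''a'' (IAdd (IVar ''a'') (IVar ''nq''))))"

definition prepare :: com where
  "prepare = Seq (Seq (ISet ''nq'' (IConst 0)) (Seq (RSet ''big'' (RConst 1)) (ISet ''a'' (IConst 0))))
     (Seq (For ''i'' (IVar ''n'') prepare_row) prepare_slots)"

context tables
begin

lemma runs_prepare:
  assumes big: "big = 1 + (\<Sum>x<n. sv x)"
    and m: "ints m ''n'' 0 = int n" "ints m ''Q'' 0 = int W + 1"
      "\<And>x. x < n \<Longrightarrow> ints m ''par'' (int x) = int (par x)"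
      "\<And>x. x < n \<Longrightarrow> ints m ''w'' (ints m ''ord'' (int x)) = int (wt x)"
      "\<And>x. x < n \<Longrightarrow> reals m ''s'' (ints m ''ord'' (int x)) = sv x"
  shows "runs prepare m (n * 150 + 60) (\<lambda>m'. ready m' \<and> same prepare m m')"
proof (rule runs_same)
  let ?m = "write_int ''a'' 0 0 (write_real ''big'' 0 1 (write_int ''nq'' 0 0 m))"
  let ?rows = "For ''i'' (IVar ''n'') prepare_row"
  let ?I = "\<lambda>k m'. ints m' ''nq'' 0 = int (k * Suc W) \<and> reals m' ''big'' 0 = 1 + (\<Sum>x<k. sv x) \<and>
    (\<forall>x<k. ints m' ''pw'' (int x) = int (wt x) \<and> reals m' ''ps'' (int x) = sv x \<and>
       ints m' ''ro'' (int x) = int (x * Suc W))"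
  have "runs (Seq (ISet ''nq'' (IConst 0)) (Seq (RSet ''big'' (RConst 1)) (ISet ''a'' (IConst 0))))
      m 20 (\<lambda>m'. m' = ?m)"
    by (rule runs_flat) simp_all
  moreover have "runs (Seq ?rows prepare_slots) ?m ((n * 62 + 9) + (2 * n * 40 + 12)) ready"
  proof (rule runs_Seq)
    show "runs ?rows ?m (n * 62 + 9) (\<lambda>m'. ?I n m' \<and> same ?rows ?m m')"
    proof (rule runs_For[where Inv = ?I and T = 50])
      show "?I 0 ?m" by simp
      show "''i'' \<notin> imods prepare_row" by (simp add: prepare_row_def)
      show "ival (IVar ''n'') m' = int n" if "same ?rows ?m m'" for m'
        using same_ints[OF that, of "''n''"] m by (simp add: prepare_row_def)
      show "?I k (write_int ''i'' 0 x m')" if "?I k m'" for k m' x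
        using that by simp
      fix k m' assume k: "k < n" "ints m' ''i'' 0 = int k" and I: "?I k m'" and s: "same ?rows ?m m'"
      have "ints m' ''ord'' = ints m ''ord''" "ints m' ''w'' = ints m ''w''"
        "ints m' ''Q'' = ints m ''Q''" "reals m' ''s'' = reals m ''s''"
        using same_ints[OF s, of "''ord''"] same_ints[OF s, of "''w''"]
          same_ints[OF s, of "''Q''"] same_reals[OF s, of "''s''"]
        by (simp_all add: prepare_row_def)
      then have "run prepare_row m' = write_int ''nq'' 0 (int (Suc k * Suc W))
        (write_int ''ro'' (int k) (int (k * Suc W)) (write_real ''big'' 0 (1 + (\<Sum>x<Suc k. sv x))
        (write_real ''ps'' (int k) (sv k) (write_int ''pw'' (int k) (int (wt k)) m'))))"
        using I k m(2) m(4)[OF k(1)] m(5)[OF k(1)] by (simp add: prepare_row_def algebra_simps)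
      then show "runs prepare_row m' 50 (?I (Suc k))"
        using I by (intro runs_flat) (auto simp: less_Suc_eq prepare_row_def)
    qed simp_all
    fix m1 assume m1: "?I n m1 \<and> same ?rows ?m m1"
    then have s1: "same ?rows ?m m1" by blast
    let ?body = "Seq (IWrite ''off'' (IVar ''i'') (IVar ''a'')) (ISet ''a'' (IAdd (IVar ''a'') (IVar ''nq'')))"
    let ?J = "\<lambda>k m'. ints m' ''a'' 0 = int (k * (n * Suc W)) \<and>
      (\<forall>x<k. ints m' ''off'' (int x) = int (x * (n * Suc W)))"
    have nm: "ints m1 ''n'' = ints m ''n''" "ints m1 ''Q'' = ints m ''Q''" "ints m1 ''par'' = ints m ''par''"
      "ints m1 ''a'' 0 = 0"
      using same_ints[OF s1, of "''n''"] same_ints[OF s1, of "''Q''"] same_ints[OF s1, of "''par''"]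
        same_ints[OF s1, of "''a''"]
      by (simp_all add: prepare_row_def)
    have "runs prepare_slots m1 (2 * n * 40 + 12) (\<lambda>m'. ?J (2 * n) m' \<and> same prepare_slots m1 m')"
      unfolding prepare_slots_def
    proof (rule runs_For[where Inv = ?J and T = 15])
      let ?c = "For ''i'' (IAdd (IVar ''n'') (IVar ''n'')) ?body"
      show "?J 0 m1" using nm by simp
      show "ival (IAdd (IVar ''n'') (IVar ''n'')) m' = int (2 * n)" if "same ?c m1 m'" for m'
        using same_ints[OF that, of "''n''"] nm m by simp
      fix k m' assume k: "k < 2 * n" "ints m' ''i'' 0 = int k" and J: "?J k m'" and s: "same ?c m1 m'"
      have nq: "ints m' ''nq'' 0 = int (n * Suc W)" using same_ints[OF s, of "''nq''"] m1 by simp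
      have "run ?body m' = write_int ''a'' 0 (int (Suc k * (n * Suc W)))
        (write_int ''off'' (int k) (int (k * (n * Suc W))) m')"
        using J k nq by (simp add: algebra_simps)
      then show "runs ?body m' 15 (?J (Suc k))"
        using J by (intro runs_flat) (auto simp: less_Suc_eq)
    qed simp_all
    then show "runs prepare_slots m1 (2 * n * 40 + 12) ready"
    proof (rule runs_mono)
      fix m' assume m': "?J (2 * n) m' \<and> same prepare_slots m1 m'"
      then have s: "same prepare_slots m1 m'" by blast
      have i: "ints m' x = ints m1 x" if "x \<notin> {''i'', ''off'', ''a''}" for x
        using that by (intro same_ints[OF s]) (auto simp: prepare_slots_def)
      have r: "reals m' x = reals m1 x" for x
        by (intro same_reals[OF s]) (auto simp: prepare_slots_def)
      show "ready m'"
        unfolding ready_def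
      proof (intro conjI allI impI)
        show "ints m' ''n'' 0 = int n" "ints m' ''Q'' 0 = int W + 1" using i nm m by simp_all
        show "reals m' ''big'' 0 = big" using r m1 big by simp
        fix x assume x: "x < n"
        show "ints m' ''par'' (int x) = int (par x)" using i nm m(3) x by simp
        show "ints m' ''pw'' (int x) = int (wt x)" using i m1 x by simp
        show "reals m' ''ps'' (int x) = sv x" using r m1 x by simp
        show "ints m' ''ro'' (int x) = int (x * Suc W)" using i[of "''ro''"] m1 x by simp
      next
        show "ints m' ''off'' (int x) = int (x * (n * Suc W))" if "x < 2 * n" for x
          using m' that by blast
      qed
    qed simp
  qed
  ultimately have "runs prepare m (20 + ((n * 62 + 9) + (2 * n * 40 + 12))) ready"
    unfolding prepare_def by - (erule runs_Seq, simp)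
  then show "runs prepare m (n * 150 + 60) ready"
    by (rule runs_mono) simp_all
qed

end

section \<open>The whole program\<close>

definition program :: com where
  "program = Seq count_budget (Seq explore (Seq prepare (Seq init (Seq merge (Seq trace report)))))"

lemma input_ints_simps:
  "input_ints I ''n'' 0 = int (num_nodes I)"
  "input_ints I ''m'' 0 = int (length (edge_list I))"
  "k < length (edge_list I) \<Longrightarrow> input_ints I ''fst'' (int k) = int (fst (edge_list I ! k))"
  "k < length (edge_list I) \<Longrightarrow> input_ints I ''snd'' (int k) = int (snd (edge_list I ! k))"
  "i \<in> nodes I \<Longrightarrow> input_ints I ''w'' (int i) = \<lfloor>weight I i\<rfloor>"
  "input_ints I ''pos'' l = 0"
  by (simp_all add: input_ints_def nodes_def)

lemma input_reals_simps:
  "i \<in> nodes I \<Longrightarrow> input_reals I ''s'' (int i) = param I i"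
  "input_reals I ''w0'' 0 = threshold I"
  by (simp_all add: input_reals_def nodes_def)

lemma runs_explore_input:
  assumes valid: "valid_instance I"
    and m: "same count_budget (input_memory I) m"
  shows "runs explore m (num_nodes I * (num_nodes I * 120 + 21) + 40)
    (\<lambda>m'. (\<exists>ord par. explored_by (nodes I) (edges I) (num_nodes I) ord par m') \<and> same explore m m')"
proof -
  have *: "ints m x = input_ints I x" if "x \<noteq> ''Q''" for x
    using same_ints[OF m, of x] that by (simp add: count_budget_def input_memory_def)
  have r: "runs explore m (num_nodes I * (length (edge_list I) * 120 + 21) + 40)
    (\<lambda>m'. (\<exists>ord par. explored_by (nodes I) (edges I) (num_nodes I) ord par m') \<and> same explore m m')"
    by (rule runs_explore[OF valid]) (simp_all add: * input_ints_simps)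
  \<comment> \<open>\<open>runs\<close> asserts that an end state exists, so the execution itself
    supplies the search order that bounds the number of edges and thereby its own time.\<close>
  then obtain ord par where "search_order (nodes I) (edges I) (num_nodes I) ord par"
    unfolding runs_def explored_by_def by blast
  then have "length (edge_list I) \<le> num_nodes I" by (rule edge_list_length[OF valid])
  with r show ?thesis
    by (elim runs_mono) (simp_all add: mult_le_mono)
qed

lemma runs_solve:
  assumes valid: "valid_instance I" and integral: "\<forall>i\<in>nodes I. weight I i \<in> \<int>"
    and W: "W = nat \<lfloor>threshold I\<rfloor>" and Q: "ints m ''Q'' 0 = int W + 1"
    and n: "ints m ''n'' 0 = int n" "n = num_nodes I"
    and ex: "explored_by (nodes I) (edges I) n ord par m"
    and w: "\<And>i. i \<in> nodes I \<Longrightarrow> ints m ''w'' (int i) = \<lfloor>weight I i\<rfloor>"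
    and s: "\<And>i. i \<in> nodes I \<Longrightarrow> reals m ''s'' (int i) = param I i"
  shows "runs (Seq prepare (Seq init (Seq merge (Seq trace report)))) m
    ((n * 150 + 60) + ((n * (n * (Suc W * 72 + 21) + 26) + 9) +
      ((n * (n * (Suc W * (Suc W * 120 + 72) + 150) + 212) + 9) +
        ((n * 94 + 50) + (n * 20 + 40))))) (correct_output I)"
proof -
  define wt where "wt = (\<lambda>x. nat \<lfloor>weight I (ord x)\<rfloor>)"
  define sv where "sv = (\<lambda>x. param I (ord x))"
  define big where "big = 1 + (\<Sum>x<n. sv x)"
  have so: "search_order (nodes I) (edges I) n ord par" using ex by (simp add: explored_by_def)
  have inj: "inj_on ord {..<n}" and ordN: "\<And>x. x < n \<Longrightarrow> ord x \<in> nodes I"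
    using so by (auto simp: search_order_def)
  have nodes: "nodes I = ord ` {..<n}"
    using card_subset_eq[of "nodes I" "ord ` {..<n}"] inj ordN n(2)
    by (force simp: nodes_def card_image)
  have nonneg: "0 \<le> weight I i" "0 \<le> param I i" if "i \<in> nodes I" for i
    using valid that by (auto simp: valid_instance_def)
  have sv: "0 \<le> sv x" if "x < n" for x using nonneg ordN that by (simp add: sv_def)
  then have big0: "0 \<le> big" "(\<Sum>x<n. sv x) < big"
    by (auto simp: big_def intro!: add_nonneg_nonneg sum_nonneg)
  interpret tables n W par wt sv big
    using so ex by unfold_locales (auto simp: search_order_def explored_by_def)
  have ord: "ints m ''ord'' (int x) = int (ord x)" if "x < n" for x
    using ex that by (simp add: explored_by_def)
  show ?thesis
  proof (rule runs_Seq)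
    show "runs prepare m (n * 150 + 60) (\<lambda>m'. ready m' \<and> same prepare m m')"
    proof (rule runs_prepare)
      show "ints m ''w'' (ints m ''ord'' (int x)) = int (wt x)" if "x < n" for x
        using w nonneg ordN ord that by (simp add: wt_def)
      show "reals m ''s'' (ints m ''ord'' (int x)) = sv x" if "x < n" for x
        using s ordN ord that by (simp add: sv_def)
      show "ints m ''par'' (int x) = int (par x)" if "x < n" for x
        using ex that by (simp add: explored_by_def)
    qed (use n Q big_def in simp_all)
    fix m1 assume m1: "ready m1 \<and> same prepare m m1"
    show "runs (Seq init (Seq merge (Seq trace report))) m1
      ((n * (n * (Suc W * 72 + 21) + 26) + 9) +
        ((n * (n * (Suc W * (Suc W * 120 + 72) + 150) + 212) + 9) +
          ((n * 94 + 50) + (n * 20 + 40)))) (correct_output I)"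
    proof (rule runs_Seq)
      show "runs init m1 (n * (n * (Suc W * 72 + 21) + 26) + 9)
        (\<lambda>m'. initial n m' \<and> same init m1 m')"
        using m1 by (intro runs_init) simp_all
      fix m2 assume m2: "initial n m2 \<and> same init m1 m2"
      have r2: "ready m2"
        using m1 m2 by (elim conjE, intro ready_same[of m1 init m2])
          (simp_all add: init_def fill_def init_cell_def)
      show "runs (Seq merge (Seq trace report)) m2
        ((n * (n * (Suc W * (Suc W * 120 + 72) + 150) + 212) + 9) +
          ((n * 94 + 50) + (n * 20 + 40))) (correct_output I)"
      proof (rule runs_Seq)
        show "runs merge m2 (n * (n * (Suc W * (Suc W * 120 + 72) + 150) + 212) + 9)
          (\<lambda>m'. merging n m' \<and> same merge m2 m')"
          using r2 m2 by (intro runs_merge) simp_all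
        fix m3 assume m3: "merging n m3 \<and> same merge m2 m3"
        have r3: "ready m3"
          using r2 m3 by (elim conjE, intro ready_same[of m2 merge m3])
            (simp_all add: merge_def merge_step_def merge_setup_def select_def fill_def merge_cell_def)
        interpret solved n W par wt sv big m3
          using r3 m3 sv big0 by unfold_locales auto
        have "ints m3 ''ord'' = ints m2 ''ord''"
          using m3 by (intro same_ints[of merge]) (simp_all add: merge_def merge_step_def
            merge_setup_def select_def fill_def merge_cell_def)
        also have "\<dots> = ints m1 ''ord''"
          using m2 by (intro same_ints[of init]) (simp_all add: init_def fill_def init_cell_def)
        also have "\<dots> = ints m ''ord''"
          using m1 by (intro same_ints[of prepare])
            (simp_all add: prepare_def prepare_row_def prepare_slots_def)
        finally have ord3: "ints m3 ''ord'' (int x) = int (ord x)" if "x < n" for x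
          using ord that by simp
        have thr: "0 \<le> threshold I" using valid by (simp add: valid_instance_def)
        interpret tp: tree_partition_dp n W par wt sv big "\<lambda>c x. tab m3 (slot (n - c) x)"
          "\<lambda>c. reals m3 ''g'' (int c)" "\<lambda>c. nat (ints m3 ''bj'' (int c))"
          "\<lambda>c. ctab m3 (n + c)" I ord
        proof
          show "real (wt x) = weight I (ord x)" if "x < n" for x
          proof -
            \<comment> \<open>Integrality enters here: the input holds the floor of each weight,
              which then is the weight itself.\<close>
            have "weight I (ord x) \<in> \<int>" "0 \<le> weight I (ord x)"
              using integral nonneg ordN[OF that] by auto
            then show ?thesis by (auto simp: wt_def elim!: Ints_cases)
          qed
          show "real W \<le> threshold I" "threshold I < real W + 1"
            using thr by (simp_all add: W)
        qed (use valid so nodes big0 sv_def in simp_all)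
        show "runs (Seq trace report) m3 ((n * 94 + 50) + (n * 20 + 40)) (correct_output I)"
        proof (rule runs_Seq)
          show "runs trace m3 (n * 94 + 50) (\<lambda>m. tracing (n - 1) m \<and> same trace m3 m)"
            by (rule runs_trace)
          fix m4 assume m4: "tracing (n - 1) m4 \<and> same trace m3 m4"
          show "runs report m4 (n * 20 + 40) (correct_output I)"
            by (rule runs_mono[OF runs_report[OF _ _ inj ord3]])
              (use m4 tp.correct_outputI in auto)
        qed
      qed
    qed
  qed
qed

text \<open>These are the monomials of the running time. Expressing it in \<open>Q = W + 1\<close>,
  which is at least 1, keeps the leading term dominant also for \<open>W = 0\<close>.\<close>

lemma time_bound:
  fixes n Q :: nat
  assumes "1 \<le> n" "1 \<le> Q"
  shows "1 \<le> n * n * (Q * Q)" "n \<le> n * n * (Q * Q)" "Q \<le> n * n * (Q * Q)"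
    "n * n \<le> n * n * (Q * Q)" "n * n * Q \<le> n * n * (Q * Q)"
proof -
  have "1 \<le> n * n" "1 \<le> Q * Q" "n \<le> n * n" "Q \<le> Q * Q" using assms by simp_all
  then show "1 \<le> n * n * (Q * Q)" "n \<le> n * n * (Q * Q)" "Q \<le> n * n * (Q * Q)"
    "n * n \<le> n * n * (Q * Q)" "n * n * Q \<le> n * n * (Q * Q)"
    using mult_le_mono[of 1 "n * n" 1 "Q * Q"] mult_le_mono[of n "n * n" 1 "Q * Q"]
      mult_le_mono[of 1 "n * n" Q "Q * Q"] mult_le_mono[of "n * n" "n * n" 1 "Q * Q"]
      mult_le_mono[of "n * n" "n * n" Q "Q * Q"]
    by simp_all
qed

lemma runs_program:
  assumes valid: "valid_instance I" and integral: "\<forall>i\<in>nodes I. weight I i \<in> \<int>"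
  defines "n \<equiv> num_nodes I" and "Q \<equiv> Suc (nat \<lfloor>threshold I\<rfloor>)"
  shows "runs program (input_memory I) (2000 * (n * n * (Q * Q))) (correct_output I)"
proof -
  define W where "W = nat \<lfloor>threshold I\<rfloor>"
  have thr: "0 \<le> threshold I" using valid by (simp add: valid_instance_def)
  have w0: "reals (input_memory I) ''w0'' 0 = threshold I"
    by (simp add: input_memory_def input_reals_simps)
  let ?rest = "(n * 150 + 60) + ((n * (n * (Suc W * 72 + 21) + 26) + 9) +
      ((n * (n * (Suc W * (Suc W * 120 + 72) + 150) + 212) + 9) +
        ((n * 94 + 50) + (n * 20 + 40))))"
  have "runs program (input_memory I) ((W * 30 + 30) + ((n * (n * 120 + 21) + 40) + ?rest))
    (correct_output I)"
    unfolding program_def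
  proof (rule runs_Seq)
    show "runs count_budget (input_memory I) (W * 30 + 30)
      (\<lambda>m'. ints m' ''Q'' 0 = int W + 1 \<and> same count_budget (input_memory I) m')"
      using runs_count_budget[of "input_memory I"] thr w0 by (simp add: W_def)
    fix m assume m: "ints m ''Q'' 0 = int W + 1 \<and> same count_budget (input_memory I) m"
    have mi: "ints m x = input_ints I x" if "x \<noteq> ''Q''" for x
      using m same_ints[of count_budget "input_memory I" m x] that
      by (simp add: count_budget_def input_memory_def)
    have mr: "reals m x = input_reals I x" if "x \<noteq> ''r''" for x
      using m same_reals[of count_budget "input_memory I" m x] that
      by (simp add: count_budget_def input_memory_def)
    show "runs (Seq explore (Seq prepare (Seq init (Seq merge (Seq trace report))))) m
      ((n * (n * 120 + 21) + 40) + ?rest) (correct_output I)"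
    proof (rule runs_Seq)
      show "runs explore m (n * (n * 120 + 21) + 40)
        (\<lambda>m'. (\<exists>ord par. explored_by (nodes I) (edges I) n ord par m') \<and> same explore m m')"
        unfolding n_def using m by (intro runs_explore_input[OF valid]) simp
      fix m' assume m': "(\<exists>ord par. explored_by (nodes I) (edges I) n ord par m') \<and> same explore m m'"
      then obtain ord par where ex: "explored_by (nodes I) (edges I) n ord par m'" by blast
      have i: "ints m' x = ints m x"
        if "x \<notin> {''i'', ''e'', ''ord'', ''par'', ''cnt'', ''pos''}" for x
        using m' that by (intro same_ints[of explore])
          (simp_all add: explore_def explore_start_def scan_def visit_def)
      have r: "reals m' = reals m"
        using m' same_reals[of explore m m']
        by (simp add: explore_def explore_start_def scan_def visit_def fun_eq_iff)
      show "runs (Seq prepare (Seq init (Seq merge (Seq trace report)))) m' ?rest (correct_output I)"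
        by (rule runs_solve[OF valid integral W_def _ _ _ ex])
          (use m in \<open>simp_all add: i r mi mr n_def input_ints_simps input_reals_simps\<close>)
    qed
  qed
  moreover have "1 \<le> n"
    using valid by (auto simp: valid_instance_def is_tree_def connected_nodes_def nodes_def n_def)
  moreover have "Q = Suc W" by (simp add: Q_def W_def)
  \<comment> \<open>The coefficients of all summands add up to less than 2000.\<close>
  ultimately show ?thesis
    using time_bound[of n Q] by (elim runs_mono) (simp_all add: algebra_simps)
qed

text \<open>Correctness covers all thresholds, the time bound those from 1 on: at threshold 0 its
  right-hand side vanishes, whereas every execution takes at least one step.\<close>

theorem theorem4:
  shows "\<exists>(p :: com) (C :: real). \<forall>I :: tree_partition.
    valid_instance I \<and> (\<forall>i\<in>nodes I. weight I i \<in> \<int>) \<longrightarrow>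
    (\<exists>t m. exec p (input_memory I) t m \<and> correct_output I m \<and>
       (1 \<le> threshold I \<longrightarrow>
          real t \<le> C * ((threshold I)\<^sup>2 * (real (num_nodes I))\<^sup>2)))"
proof (rule exI[of _ program], rule exI[of _ 8000], intro allI impI)
  fix I :: tree_partition
  assume I: "valid_instance I \<and> (\<forall>i\<in>nodes I. weight I i \<in> \<int>)"
  let ?n = "num_nodes I" and ?Q = "Suc (nat \<lfloor>threshold I\<rfloor>)"
  from I obtain t m where t: "exec program (input_memory I) t m" "correct_output I m"
    "t \<le> 2000 * (?n * ?n * (?Q * ?Q))"
    using runs_program unfolding runs_def by blast
  have "real t \<le> 8000 * ((threshold I)\<^sup>2 * (real ?n)\<^sup>2)" if thr: "1 \<le> threshold I"
  proof -
    \<comment> \<open>For thresholds from 1 on the number of budgets is at most twice the threshold;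
      squaring turns 2000 into 8000.\<close>
    have "real ?Q \<le> 2 * threshold I" using thr by linarith
    then have "real ?Q * real ?Q \<le> (2 * threshold I) * (2 * threshold I)"
      using thr by (intro mult_mono) auto
    then have "real ?n * real ?n * (real ?Q * real ?Q) \<le>
        real ?n * real ?n * ((2 * threshold I) * (2 * threshold I))"
      by (intro mult_left_mono) auto
    moreover have "real t \<le> 2000 * (real ?n * real ?n * (real ?Q * real ?Q))"
      using of_nat_mono[OF t(3), where 'a = real] by (simp only: of_nat_mult of_nat_numeral)
    ultimately show ?thesis by (simp add: power2_eq_square algebra_simps)
  qed
  then show "\<exists>t m. exec program (input_memory I) t m \<and> correct_output I m \<and>
       (1 \<le> threshold I \<longrightarrow> real t \<le> 8000 * ((threshold I)\<^sup>2 * (real ?n)\<^sup>2))"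
    using t by blast
qed

end
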